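(* Let $G = P \times A$ be a finite group, where $P$ has prime-power order and $A$ is abelian. Then for every generating set $S$ of $G$, the Cayley digraph $\vec{\mathrm{Cay}}(G;S)$ has a hamiltonian path.
   Context: For a subset $S$ of a group $G$, the Cayley digraph $\vec{\mathrm{Cay}}(G;S)$ is the directed graph with vertex set $G$ and a directed edge $g \to gs$ for every $g\in G$ and $s\in S$; it is connected exactly when $S$ generates $G$. A hamiltonian path is a directed path visiting every vertex exactly once. *)

theory Defs
  imports
    "HOL-Algebra.Generated_Groups"
    "HOL-Computational_Algebra.Primes"
    "Graph_Theory.Pair_Digraph"
    "Graph_Theory.Vertex_Walk"
begin

text \<open>
  Arcs are ordered pairs of vertices, so there are no parallel arcs. There is a loop at
  every vertex if the identity belongs to \<open>S\<close>.
\<close>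

definition cayley_digraph :: "('a, 'm) monoid_scheme \<Rightarrow> 'a set \<Rightarrow> 'a pair_pre_digraph" where
  "cayley_digraph G S =
     \<lparr> pverts = carrier G,
       parcs = {(g, g \<otimes>\<^bsub>G\<^esub> s) | g s. g \<in> carrier G \<and> s \<in> S} \<rparr>"

text \<open>
  A path is given by its list of vertices; \<open>vpath\<close> requires this list to be nonempty and
  distinct and consecutive entries to be joined by an arc in the forward direction.
\<close>

definition hamiltonian_path :: "'a list \<Rightarrow> ('a, 'b) pre_digraph \<Rightarrow> bool" where
  "hamiltonian_path vs D \<longleftrightarrow> vpath vs D \<and> set vs = verts D"

lemma pair_wf_digraph_cayley_digraph:
  assumes "group G" and "S \<subseteq> carrier G"
  shows "pair_wf_digraph (cayley_digraph G S)"
proof -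
  interpret group G by fact
  show ?thesis
    using assms(2) by unfold_locales (auto simp: cayley_digraph_def)
qed

end

theory Submission
  imports
    Defs
    "HOL-Algebra.Group_Action"
    "HOL-Algebra.Multiplicative_Group"
begin

text \<open>
  Only the following is used of \<open>P \<times> A\<close>: it has a homomorphism \<open>\<pi>\<close> to a \<open>p\<close>-group with
  central kernel. This passes to subgroups, and it makes every maximal subgroup normal.

  Choose \<open>T \<subseteq> S\<close> minimal such that \<open>T\<close> generates \<open>G\<close> together with \<open>ker \<pi>\<close>. All subgroups above
  \<open>\<langle>T\<rangle>\<close> are normal, so a hamiltonian path of \<open>\<langle>T\<rangle>\<close> extends to \<open>G\<close> through cyclic quotients, one
  element of \<open>S\<close> at a time. Suppose now that \<open>S = T\<close> is minimal in this sense, and let \<open>M\<close> be the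
  subgroup generated by all \<open>s t\<^sup>-\<^sup>1\<close>. Then \<open>M \<noteq> G\<close>: for every \<open>t\<close> a homomorphism to
  \<open>\<int>/p\<close> maps \<open>t\<close> to 1 and the other generators to 0, and \<open>M\<close> lies in the kernel of the sum of
  these homomorphisms. A hamiltonian cycle \<open>s w\<close> of the coset digraph \<open>M\G\<close> combines with a
  hamiltonian path of \<open>M\<close> for the generators \<open>S w\<close>, which exists by induction.

  The hamiltonian cycle of \<open>M\G\<close> is found by descending through subgroups \<open>K\<close>. At each coset of \<open>K\<close>
  there is a set of admissible generators, all leading to the same coset, and the cycle uses
  admissible generators; the differences of admissible arcs generate \<open>K\<close>. Removing one
  generator \<open>i\<close> at one coset from a minimal such selection gives \<open>L < K\<close>, normal in \<open>K\<close>. The cycle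
  lifts to \<open>L\G\<close> if its product generates \<open>K\<close> modulo \<open>L\<close>. By the same sum of homomorphisms, this
  holds for some \<open>i\<close> and some choice of another generator at that coset.
\<close>

section \<open>Words and cyclic extensions\<close>

definition (in monoid) list_mult :: "'a list \<Rightarrow> 'a"
  where "list_mult xs = foldr (\<otimes>) xs \<one>"

context monoid
begin

lemma list_mult_Nil [simp]: "list_mult [] = \<one>"
  and list_mult_Cons [simp]: "list_mult (x # xs) = x \<otimes> list_mult xs"
  by (simp_all add: list_mult_def)

lemma list_mult_closed [simp]: "set xs \<subseteq> carrier G \<Longrightarrow> list_mult xs \<in> carrier G"
  by (induction xs) auto

lemma list_mult_append:
  "set xs \<subseteq> carrier G \<Longrightarrow> set ys \<subseteq> carrier G \<Longrightarrow>
    list_mult (xs @ ys) = list_mult xs \<otimes> list_mult ys"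
  by (induction xs) (auto simp: m_assoc)

lemma list_mult_concat_replicate:
  "set xs \<subseteq> carrier G \<Longrightarrow> list_mult (concat (replicate n xs)) = list_mult xs [^] n"
proof (induction n)
  case (Suc n)
  have "set (concat (replicate n xs)) \<subseteq> carrier G"
    using Suc.prems by (auto split: if_splits)
  then show ?case
    using Suc nat_pow_Suc2[of "list_mult xs" n] by (simp add: list_mult_append)
qed simp

end

text \<open>\<open>w\<close> is read as a walk from the identity whose vertices are the prefix
  products. There are \<open>length w + 1\<close> of these, so covering \<open>K\<close> under the
  length bound forces them to be pairwise distinct; distinctness does not have to be carried
  along.\<close>

definition (in group) ham_word :: "'a set \<Rightarrow> 'a set \<Rightarrow> 'a list \<Rightarrow> bool"
  where "ham_word K S w \<longleftrightarrow> set w \<subseteq> S \<and> length w < card K \<and>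
    (\<forall>g\<in>K. \<exists>xs ys. w = xs @ ys \<and> g = list_mult xs)"

definition (in group) normal_in :: "'a set \<Rightarrow> 'a set \<Rightarrow> bool"
  where "normal_in N K \<longleftrightarrow> subgroup N G \<and> subgroup K G \<and> N \<subseteq> K \<and>
    (\<forall>g\<in>K. \<forall>x\<in>N. g \<otimes> x \<otimes> inv g \<in> N)"

context group
begin

lemma inv_eq_nat_pow:
  assumes "finite (carrier G)" "x \<in> carrier G"
  shows "inv x = x [^] (order G - 1)"
proof -
  have "0 < order G" using assms order_gt_0_iff_finite by blast
  then have "x \<otimes> x [^] (order G - 1) = \<one>"
    using pow_order_eq_1[OF assms(2)] assms
    by (metis Suc_diff_1 nat_pow_Suc2)
  then show ?thesis using assms by (metis inv_equality l_inv nat_pow_closed inv_comm)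
qed

text \<open>Powers of \<open>c\<close> lie in \<open>K\<close>, so they can be moved past
  \<open>L\<close> by conjugation; finiteness turns the inverse of \<open>c\<close> into a power
  with natural exponent.\<close>

lemma generate_insert_in_powers:
  assumes fin: "finite (carrier G)" and nor: "normal_in L K" and c: "c \<in> K"
    and x: "x \<in> generate G (insert c L)"
  shows "\<exists>l\<in>L. \<exists>i::nat. x = l \<otimes> c [^] i"
proof -
  have sub: "subgroup L G" "subgroup K G" "L \<subseteq> K" using nor by (auto simp: normal_in_def)
  note car = subgroup.subset[OF sub(1)] subgroup.subset[OF sub(2)]
  have cc: "c \<in> carrier G" using c car by auto
  show ?thesis using x
  proof induction
    case one
    show ?case
      by (rule bexI[of _ \<one>], rule exI[of _ 0]) (use sub in \<open>auto simp: subgroup.one_closed\<close>)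
  next
    case (incl h)
    show ?case
    proof (cases "h = c")
      case True
      then show ?thesis
        by (intro bexI[of _ \<one>] exI[of _ 1]) (use sub cc in \<open>auto simp: subgroup.one_closed\<close>)
    next
      case False
      then show ?thesis
        using incl by (intro bexI[of _ h] exI[of _ 0]) (use car in auto)
    qed
  next
    case (inv h)
    show ?case
    proof (cases "h = c")
      case True
      then show ?thesis
        by (intro bexI[of _ \<one>] exI[of _ "order G - 1"])
          (use sub cc fin in \<open>auto simp: subgroup.one_closed inv_eq_nat_pow\<close>)
    next
      case False
      then have "inv h \<in> L" using inv sub by (auto simp: subgroup.m_inv_closed)
      then show ?thesis
        by (intro bexI[of _ "inv h"] exI[of _ 0]) (use car in auto)
    qed
  next
    case (eng h1 h2)
    then obtain l1 i1 l2 i2 where h: "l1 \<in> L" "l2 \<in> L"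
      "h1 = l1 \<otimes> c [^] (i1::nat)" "h2 = l2 \<otimes> c [^] (i2::nat)" by blast
    have lc: "l1 \<in> carrier G" "l2 \<in> carrier G" using h car by auto
    have "c [^] i1 \<in> K" using c sub(2)
      by (induction i1) (auto simp: subgroup.one_closed subgroup.m_closed)
    then have m: "c [^] i1 \<otimes> l2 \<otimes> inv (c [^] i1) \<in> L"
      using nor h by (auto simp: normal_in_def)
    have "h1 \<otimes> h2 = (l1 \<otimes> (c [^] i1 \<otimes> l2 \<otimes> inv (c [^] i1))) \<otimes> c [^] (i1 + i2)"
    proof -
      have "(l1 \<otimes> (c [^] i1 \<otimes> l2 \<otimes> inv (c [^] i1))) \<otimes> c [^] (i1 + i2)
        = l1 \<otimes> c [^] i1 \<otimes> l2 \<otimes> (inv (c [^] i1) \<otimes> c [^] i1) \<otimes> c [^] i2"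
        using lc cc by (simp only: nat_pow_mult[symmetric] m_assoc m_closed inv_closed nat_pow_closed)
      also have "\<dots> = h1 \<otimes> h2" using lc cc h by (simp add: m_assoc)
      finally show ?thesis by simp
    qed
    then show ?case using m h sub by (blast intro: subgroup.m_closed)
  qed
qed

text \<open>\<open>n\<close> is the order of the coset of \<open>c\<close> in \<open>K/L\<close>.
  Both decompositions are recorded: the one with \<open>L\<close> on the left serves walks on the
  cosets \<open>L g\<close>, the one with \<open>L\<close> on the right serves words that traverse
  the cosets \<open>c^i L\<close>.\<close>

lemma cyclic_extension:
  assumes fin: "finite (carrier G)" and nor: "normal_in L K" and c: "c \<in> K"
    and gen: "generate G (insert c L) = K"
  obtains n :: nat where "n > 0" "c [^] n \<in> L" "n * card L = card K"
    "\<And>g. g \<in> K \<Longrightarrow> \<exists>l\<in>L. \<exists>i<n. g = l \<otimes> c [^] i"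
    "\<And>g. g \<in> K \<Longrightarrow> \<exists>l\<in>L. \<exists>i<n. g = c [^] i \<otimes> l"
proof -
  have sub: "subgroup L G" "subgroup K G" "L \<subseteq> K" using nor by (auto simp: normal_in_def)
  note car = subgroup.subset[OF sub(1)] subgroup.subset[OF sub(2)]
  have cc: "c \<in> carrier G" using c car by auto
  define n where "n = (LEAST n. n > 0 \<and> c [^] (n::nat) \<in> L)"
  have "order G > 0 \<and> c [^] order G \<in> L"
    using pow_order_eq_1[OF cc] sub fin by (auto simp: subgroup.one_closed order_gt_0_iff_finite)
  then have n: "n > 0" "c [^] n \<in> L" unfolding n_def by (metis (mono_tags, lifting) LeastI)+
  have least: "n \<le> m" if "m > 0" "c [^] m \<in> L" for m
    unfolding n_def using that by (simp add: Least_le)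
  have powK: "c [^] (i::nat) \<in> K" for i
    using c sub(2) by (induction i) (auto simp: subgroup.one_closed subgroup.m_closed)
  have cover: "\<exists>l\<in>L. \<exists>i<n. g = l \<otimes> c [^] i" if g: "g \<in> K" for g
  proof -
    obtain l i where l: "l \<in> L" "g = l \<otimes> c [^] (i::nat)"
      using generate_insert_in_powers[OF fin nor c] g gen by blast
    have "c [^] i = (c [^] n) [^] (i div n) \<otimes> c [^] (i mod n)"
      using cc by (simp add: nat_pow_pow nat_pow_mult)
    moreover have "(c [^] n) [^] (i div n) \<in> L"
      using n(2) sub(1) by (induction "i div n" arbitrary: i) (metis nat_pow_0 subgroup.one_closed,
        metis nat_pow_Suc subgroup.m_closed nonzero_mult_div_cancel_right n(1) not_less0)
    ultimately have "g = (l \<otimes> (c [^] n) [^] (i div n)) \<otimes> c [^] (i mod n)"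
      "l \<otimes> (c [^] n) [^] (i div n) \<in> L"
      using l car cc sub(1) by (auto simp: m_assoc subgroup.m_closed subset_iff)
    then show ?thesis using mod_less_divisor[OF n(1), of i] by blast
  qed
  \<comment> \<open>Inverting a decomposition of \<open>inv g\<close> gives a negative power of
    \<open>c\<close>, which is replaced by \<open>c^(n-i)\<close> times an element of
    \<open>L\<close>. The case \<open>i = 0\<close> is separate because \<open>n - 0\<close> is not
    below \<open>n\<close>.\<close>
  have cover': "\<exists>l\<in>L. \<exists>i<n. g = c [^] i \<otimes> l" if g: "g \<in> K" for g
  proof -
    have "inv g \<in> K" using g sub by (simp add: subgroup.m_inv_closed)
    then obtain l i where l: "l \<in> L" "i < n" "inv g = l \<otimes> c [^] i"
      using cover by blast
    have lc: "l \<in> carrier G" using l car by auto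
    have gg: "g = inv (c [^] i) \<otimes> inv l"
      using l lc cc g car by (metis inv_inv inv_mult_group nat_pow_closed subsetD)
    show ?thesis
    proof (cases "i = 0")
      case True
      then show ?thesis using gg lc l n sub
        by (intro bexI[of _ "inv l"] exI[of _ 0]) (auto simp: subgroup.m_inv_closed)
    next
      case False
      have "c [^] n = c [^] i \<otimes> c [^] (n - i)"
        using l cc by (simp add: nat_pow_mult)
      then have "inv (c [^] i) = c [^] (n - i) \<otimes> inv (c [^] n)"
        using cc by (simp add: inv_mult_group m_assoc[symmetric])
      then have "g = c [^] (n - i) \<otimes> (inv (c [^] n) \<otimes> inv l)"
        using gg cc lc by (simp add: m_assoc)
      moreover have "inv (c [^] n) \<otimes> inv l \<in> L"
        using n l sub by (simp add: subgroup.m_inv_closed subgroup.m_closed)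
      moreover have "n - i < n" using False n by simp
      ultimately show ?thesis by blast
    qed
  qed
  have inj: "inj_on (\<lambda>(l, i). l \<otimes> c [^] i) (L \<times> {..<n})"
  proof -
    have *: "i = j \<and> l = l'" if "l \<in> L" "l' \<in> L" "i \<le> j" "j < n"
      "l \<otimes> c [^] i = l' \<otimes> c [^] j" for l l' and i j :: nat
    proof -
      have lc: "l \<in> carrier G" "l' \<in> carrier G" using that car by auto
      have "l \<otimes> c [^] i = (l' \<otimes> c [^] (j - i)) \<otimes> c [^] i"
        using that lc cc by (simp add: m_assoc nat_pow_mult)
      then have e: "l = l' \<otimes> c [^] (j - i)" using lc cc by simp
      then have "c [^] (j - i) = inv l' \<otimes> l" using lc cc by (simp add: m_assoc[symmetric])
      then have "c [^] (j - i) \<in> L" using that sub by (simp add: subgroup.m_closed subgroup.m_inv_closed)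
      then have "j - i = 0" using least[of "j - i"] that by (cases "j - i = 0") auto
      then show ?thesis using e lc that by auto
    qed
    show ?thesis
    proof (rule inj_onI, clarsimp)
      fix l i l' j assume a: "l \<in> L" "i < n" "l' \<in> L" "j < n" "l \<otimes> c [^] i = l' \<otimes> c [^] j"
      show "l = l' \<and> i = j"
      proof (cases "i \<le> j")
        case True then show ?thesis using *[of l l' i j] a by auto
      next
        case False then show ?thesis using *[of l' l j i] a by auto
      qed
    qed
  qed
  have img: "(\<lambda>(l, i). l \<otimes> c [^] i) ` (L \<times> {..<n}) = K"
  proof
    show "(\<lambda>(l, i). l \<otimes> c [^] i) ` (L \<times> {..<n}) \<subseteq> K"
      using sub powK by (auto intro: subgroup.m_closed)
    show "K \<subseteq> (\<lambda>(l, i). l \<otimes> c [^] i) ` (L \<times> {..<n})" using cover by force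
  qed
  have "n * card L = card K"
    using card_image[OF inj] img by (simp add: card_cartesian_product mult.commute)
  then show thesis using that n cover cover' by blast
qed

end

section \<open>Maximal subgroups of p-groups\<close>

text \<open>Every orbit of length above 1 has length divisible by \<open>p\<close>. If
  \<open>x\<close> were the only fixed point in \<open>E'\<close>, the remaining points would split
  into such orbits, and \<open>p\<close> would divide both \<open>card E'\<close> and
  \<open>card E' - 1\<close>.\<close>

lemma (in group_action) p_group_fixed_points:
  assumes p: "prime (p::nat)" and ord: "order G = p ^ m" and E': "E' \<subseteq> E" "finite E'"
    and inv: "\<And>g y. g \<in> carrier G \<Longrightarrow> y \<in> E' \<Longrightarrow> \<phi> g y \<in> E'"
    and dvd: "p dvd card E'"
    and x: "x \<in> E'" "\<And>g. g \<in> carrier G \<Longrightarrow> \<phi> g x = x"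
  shows "\<exists>y\<in>E'. y \<noteq> x \<and> (\<forall>g\<in>carrier G. \<phi> g y = y)"
proof (rule ccontr)
  assume none: "\<not> ?thesis"
  let ?C = "orbit G \<phi> ` (E' - {x})"
  have sub: "orbit G \<phi> y \<subseteq> E' - {x}" if y: "y \<in> E' - {x}" for y
  proof
    fix z assume z: "z \<in> orbit G \<phi> y"
    then obtain g where g: "g \<in> carrier G" "z = \<phi> g y" by (auto simp: orbit_def)
    have zE: "z \<in> E'" using inv g y by auto
    moreover have "z \<noteq> x"
    proof
      assume "z = x"
      then have "y \<in> orbit G \<phi> x" using orbit_sym[of y z] z y zE E' by auto
      then show False using x y by (auto simp: orbit_def)
    qed
    ultimately show "z \<in> E' - {x}" by auto
  qed
  have un: "\<Union>?C = E' - {x}"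
    using sub orbit_refl E' by blast
  have "p dvd card (orbit G \<phi> y)" if y: "y \<in> E' - {x}" for y
  proof -
    have "card (orbit G \<phi> y) dvd p ^ m"
      using orbit_stabilizer_theorem[of y] y E' ord by (metis DiffD1 dvd_triv_left subsetD)
    then obtain i where i: "card (orbit G \<phi> y) = p ^ i"
      using divides_primepow_nat[OF p] by blast
    have "i \<noteq> 0"
    proof
      assume "i = 0"
      then obtain z where "orbit G \<phi> y = {z}" using i by (auto simp: card_1_singleton_iff)
      moreover have "y \<in> orbit G \<phi> y" using orbit_refl y E' by auto
      ultimately have "\<phi> g y = y" if "g \<in> carrier G" for g
        using that by (auto simp: orbit_def)
      then show False using none y by auto
    qed
    then show ?thesis using i by auto
  qed
  moreover have "c1 \<inter> c2 = {}" if "c1 \<in> ?C" "c2 \<in> ?C" "c1 \<noteq> c2" for c1 c2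
    using disjoint_union[of c1 c2] that E' by (auto simp: orbits_def)
  ultimately have "p dvd card (\<Union>?C)"
    by (intro dvd_partition) (use un E' in auto)
  then have "p dvd card E' - 1" using un x E' by simp
  moreover have "card E' > 0" using x E' by (auto simp: card_gt_0_iff)
  ultimately have "p dvd 1" using dvd by (metis Suc_diff_1 dvd_add_right_iff plus_1_eq_Suc add.commute)
  then show False using p by (simp add: prime_nat_iff)
qed

context group
begin

text \<open>Maximality is expressed as generation by one further element, the form needed to build
  homomorphisms to a cyclic group.\<close>

lemma exists_maximal_subgroup:
  assumes "finite (carrier G)" "subgroup M G" "M \<noteq> carrier G"
  obtains N where "subgroup N G" "M \<subseteq> N" "N \<noteq> carrier G"
    "\<And>x. x \<in> carrier G - N \<Longrightarrow> generate G (insert x N) = carrier G"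
proof -
  define A where "A = {N. subgroup N G \<and> M \<subseteq> N \<and> N \<noteq> carrier G}"
  have "A \<subseteq> Pow (carrier G)" unfolding A_def by (auto dest: subgroup.subset)
  then have fin: "finite A" by (rule finite_subset) (simp add: assms(1))
  have "M \<in> A" using assms by (simp add: A_def)
  then have "\<exists>N\<in>A. M \<subseteq> N \<and> (\<forall>N'\<in>A. N \<subseteq> N' \<longrightarrow> N = N')"
    by (rule finite_has_maximal2[OF fin])
  then obtain N where NA: "N \<in> A" and max: "M \<subseteq> N \<and> (\<forall>N'\<in>A. N \<subseteq> N' \<longrightarrow> N = N')"
    by (rule bexE)
  have Nmax: "N = N'" if "N' \<in> A" "N \<subseteq> N'" for N'
    by (rule max[THEN conjunct2, rule_format, OF that])
  have N: "subgroup N G" "M \<subseteq> N" "N \<noteq> carrier G" using NA by (simp_all add: A_def)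
  show thesis
  proof (rule that)
    fix x assume x: "x \<in> carrier G - N"
    have sub: "insert x N \<subseteq> carrier G" using x subgroup.subset[OF N(1)] by auto
    have gen: "subgroup (generate G (insert x N)) G" by (rule generate_is_subgroup[OF sub])
    have incl: "insert x N \<subseteq> generate G (insert x N)" by (auto intro: generate.incl)
    show "generate G (insert x N) = carrier G"
    proof (rule ccontr)
      assume "generate G (insert x N) \<noteq> carrier G"
      then have "generate G (insert x N) \<in> A" using gen incl N by (auto simp: A_def)
      then have "N = generate G (insert x N)" by (rule Nmax) (use incl in auto)
      then show False using incl x by auto
    qed
  qed (use N in auto)
qed

text \<open>A maximal subgroup that is not normal is its own normaliser, so the number of its
  conjugates is a power of \<open>p\<close> above 1. \<open>R\<close> permutes them by conjugation
  and fixes itself, hence fixes another conjugate \<open>Y\<close>; but this forces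
  \<open>Y = R\<close>.\<close>

lemma p_group_maximal_subgroup_normal:
  assumes p: "prime (p::nat)" and ord: "order G = p ^ k" and R: "subgroup R G"
    and max: "\<And>x. x \<in> carrier G - R \<Longrightarrow> generate G (insert x R) = carrier G"
    and g: "g \<in> carrier G" and x: "x \<in> R"
  shows "g \<otimes> x \<otimes> inv g \<in> R"
proof (rule ccontr)
  assume nn: "g \<otimes> x \<otimes> inv g \<notin> R"
  have fin: "finite (carrier G)"
    using ord p order_gt_0_iff_finite by (metis prime_gt_0_nat zero_less_power)
  \<comment> \<open>Conjugation acts on the set of all subgroups; the orbit of \<open>R\<close>
    consists of its conjugates and the stabiliser of \<open>R\<close> is its normaliser.\<close>
  define \<phi> where "\<phi> = (\<lambda>g. \<lambda>H \<in> {H. subgroup H G}. g <# H #> (inv g))"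
  have \<phi>: "\<phi> h H = h <# H #> inv h" if "subgroup H G" for h H
    using that by (simp add: \<phi>_def)
  interpret act: group_action G "{H. subgroup H G}" \<phi>
    unfolding \<phi>_def by (rule action_by_conjugation_on_subgroups_set)
  have conj: "h <# H #> inv h = (\<lambda>y. h \<otimes> y \<otimes> inv h) ` H" for h H
    by (auto simp: l_coset_def r_coset_def)
  have Rc: "R \<subseteq> carrier G" using R subgroup.subset by auto
  let ?N = "stabilizer G \<phi> R"
  have N: "subgroup ?N G" using act.stabilizer_subgroup R by auto
  have RN: "R \<subseteq> ?N"
  proof
    fix h assume h: "h \<in> R"
    have "h <# R #> inv h = R"
      using h R by (simp add: coset_join3 coset_join2 subgroup.m_inv_closed subgroup.mem_carrier)
    then show "h \<in> ?N" using h Rc R by (auto simp: stabilizer_def \<phi>)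
  qed
  have "g \<notin> ?N" using nn x R by (auto simp: stabilizer_def \<phi> conj)
  have NR: "?N = R"
  proof (rule ccontr)
    assume "?N \<noteq> R"
    then obtain y where y: "y \<in> ?N" "y \<notin> R" using RN by blast
    then have "generate G (insert y R) \<subseteq> ?N" by (intro generate_subgroup_incl) (use N RN in auto)
    moreover have "generate G (insert y R) = carrier G"
      using max y subgroup.subset[OF N] by blast
    ultimately show False using \<open>g \<notin> ?N\<close> g by auto
  qed
  let ?E = "orbit G \<phi> R"
  have RE: "R \<in> ?E" using act.orbit_refl R by auto
  have Esub: "?E \<subseteq> {H. subgroup H G}"
    using R act.element_image unfolding orbit_def by blast
  have finE: "finite ?E"
    by (rule finite_subset[of _ "Pow (carrier G)"]) (use fin Esub in \<open>auto dest: subgroup.subset\<close>)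
  have cE: "card ?E * card R = p ^ k"
    using act.orbit_stabilizer_theorem[of R] R unfolding NR ord by simp
  obtain m where m: "card R = p ^ m" using cE divides_primepow_nat[OF p] by (metis dvd_triv_right)
  obtain i where i: "card ?E = p ^ i" using cE divides_primepow_nat[OF p] by (metis dvd_triv_left)
  have "i \<noteq> 0"
  proof
    assume "i = 0"
    then have "card R = card (carrier G)" using cE i ord by (simp add: order_def)
    then have "R = carrier G" using Rc fin by (simp add: card_subset_eq)
    then show False using nn g x by auto
  qed
  then have pE: "p dvd card ?E" using i by auto
  interpret Ract: group_action "G\<lparr>carrier := R\<rparr>" "{H. subgroup H G}" \<phi>
    by (rule act.induced_action[OF R])
  have "\<exists>Y\<in>?E. Y \<noteq> R \<and> (\<forall>h\<in>carrier (G\<lparr>carrier := R\<rparr>). \<phi> h Y = Y)"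
  proof (rule Ract.p_group_fixed_points[OF p _ Esub finE _ pE RE])
    show "order (G\<lparr>carrier := R\<rparr>) = p ^ m" using m by (simp add: order_def)
    show "\<phi> h Y \<in> ?E" if "h \<in> carrier (G\<lparr>carrier := R\<rparr>)" "Y \<in> ?E" for h Y
    proof -
      have h: "h \<in> carrier G" using that Rc by auto
      have Y: "Y \<in> {H. subgroup H G}" using that Esub by blast
      have "\<phi> h Y \<in> {H. subgroup H G}" by (rule act.element_image[OF h Y refl])
      then show ?thesis
        using act.orbit_trans[of R Y "\<phi> h Y"] that h R Y by (auto simp: orbit_def)
    qed
    show "\<phi> h R = R" if "h \<in> carrier (G\<lparr>carrier := R\<rparr>)" for h
      using RN that by (auto simp: stabilizer_def \<phi>)
  qed
  then obtain Y where Y: "Y \<in> ?E" "Y \<noteq> R" "\<And>h. h \<in> R \<Longrightarrow> \<phi> h Y = Y" by auto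
  then obtain a where a: "a \<in> carrier G" "Y = \<phi> a R" by (auto simp: orbit_def)
  have Ya: "Y = (\<lambda>y. a \<otimes> y \<otimes> inv a) ` R" using a R by (simp add: \<phi> conj)
  have "Y \<subseteq> carrier G" "subgroup Y G" using Y(1) Esub by (auto dest: subgroup.subset)
  \<comment> \<open>\<open>R\<close> fixes \<open>Y\<close>, which is \<open>R\<close> conjugated by
    \<open>a\<close>. So the elements of \<open>R\<close> conjugated back by \<open>a\<close>
    normalise \<open>R\<close>, and the normaliser is \<open>R\<close> itself.\<close>
  have sub: "inv a \<otimes> h \<otimes> a \<in> R" if h: "h \<in> R" for h
  proof -
    have hc: "h \<in> carrier G" using h Rc by auto
    have eq: "\<phi> (inv a \<otimes> h \<otimes> a) R = R"
    proof -
      have "\<phi> (inv a \<otimes> h \<otimes> a) R = \<phi> (inv a \<otimes> (h \<otimes> a)) R"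
        using a(1) hc by (simp add: m_assoc)
      also have "\<dots> = \<phi> (inv a) (\<phi> (h \<otimes> a) R)"
        by (rule act.composition_rule) (use a(1) hc R in auto)
      also have "\<phi> (h \<otimes> a) R = \<phi> h (\<phi> a R)"
        by (rule act.composition_rule) (use a(1) hc R in auto)
      also have "\<phi> h (\<phi> a R) = Y" using Y(3)[OF h] a(2) by simp
      also have "\<phi> (inv a) Y = R" by (rule act.orbit_sym_aux) (use a R in auto)
      finally show ?thesis .
    qed
    then have "inv a \<otimes> h \<otimes> a \<in> ?N" using a hc by (simp add: stabilizer_def \<phi>)
    then show ?thesis using NR by simp
  qed
  have "R \<subseteq> Y"
  proof
    fix h assume h: "h \<in> R"
    have "h = a \<otimes> (inv a \<otimes> h \<otimes> a) \<otimes> inv a"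
    proof -
      have "h \<in> carrier G" using h Rc by auto
      then have "a \<otimes> (inv a \<otimes> h \<otimes> a) \<otimes> inv a = (a \<otimes> inv a) \<otimes> h \<otimes> (a \<otimes> inv a)"
        using a(1) by (simp only: m_assoc m_closed inv_closed)
      then show ?thesis using a(1) \<open>h \<in> carrier G\<close> by simp
    qed
    then show "h \<in> Y" using sub[OF h] Ya by blast
  qed
  moreover have "card Y \<le> card R" using Ya Rc fin by (simp add: card_image_le finite_subset)
  ultimately have "R = Y"
    using \<open>Y \<subseteq> carrier G\<close> fin by (metis card_seteq finite_subset)
  then show False using Y by simp
qed

section \<open>Exponents and homomorphisms to a cyclic group of order p\<close>

lemma prime_dvd_exponent_in_subgroup:
  assumes p: "prime (p::nat)" and N: "subgroup N G" and x: "x \<in> carrier G" "x \<notin> N"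
    and pow: "x [^] (p ^ e) \<in> N" and d: "x [^] (d::nat) \<in> N"
  shows "p dvd d"
proof (rule ccontr)
  have powN: "y [^] (u::nat) \<in> N" if "y \<in> N" for y u
    using that N by (induction u) (auto simp: subgroup.one_closed subgroup.m_closed)
  assume nd: "\<not> p dvd d"
  then have "coprime p d" using p by (simp add: prime_imp_coprime)
  then have "gcd d (p ^ e) = 1" by (simp add: coprime_commute coprime_power_right_iff flip: coprime_iff_gcd_eq_1)
  moreover have "d \<noteq> 0" using nd by (metis dvd_0_right)
  \<comment> \<open>Bezout with natural coefficients: the surplus 1 in the exponent exhibits
    \<open>x\<close> as a quotient of two elements of \<open>N\<close>.\<close>
  ultimately obtain u v where uv: "d * u = p ^ e * v + 1"
    using bezout_nat[of d "p ^ e"] by auto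
  have "x [^] (d * u) = x [^] (p ^ e * v) \<otimes> x" using uv x by simp
  then have "x = inv (x [^] (p ^ e * v)) \<otimes> x [^] (d * u)"
    using x by (simp add: m_assoc[symmetric])
  moreover have "x [^] (p ^ e * v) \<in> N" "x [^] (d * u) \<in> N"
    using powN[OF pow, of v] powN[OF d, of u] x by (simp_all add: nat_pow_pow)
  ultimately have "x \<in> N" using N by (metis subgroup.m_closed subgroup.m_inv_closed)
  then show False using x by simp
qed

text \<open>The quotient by \<open>N j\<close> is cyclic, generated by the image of
  \<open>x j\<close>, and its order is a nontrivial power of \<open>p\<close>. Reading the exponent
  of \<open>x j\<close> modulo \<open>p\<close> is therefore a homomorphism that sends
  \<open>x j\<close> to 1 and every other \<open>x i\<close> to 0. The sum of these over
  \<open>J\<close> sends all \<open>x i\<close> to 1; its kernel is \<open>M\<close>.\<close>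

lemma exists_common_normal_subgroup:
  assumes fin: "finite (carrier G)" and p: "prime (p::nat)" and J: "finite J" "J \<noteq> {}"
    and N: "\<And>j. j \<in> J \<Longrightarrow> normal_in (N j) (carrier G)"
    and x: "\<And>j. j \<in> J \<Longrightarrow> x j \<in> carrier G"
    and gen: "\<And>j. j \<in> J \<Longrightarrow> generate G (insert (x j) (N j)) = carrier G"
    and notin: "\<And>j. j \<in> J \<Longrightarrow> x j \<notin> N j"
    and isin: "\<And>i j. i \<in> J \<Longrightarrow> j \<in> J \<Longrightarrow> i \<noteq> j \<Longrightarrow> x i \<in> N j"
    and pow: "\<And>j. j \<in> J \<Longrightarrow> x j [^] (p ^ e) \<in> N j"
  obtains M where "normal_in M (carrier G)" "M \<noteq> carrier G" "(\<Inter>j\<in>J. N j) \<subseteq> M"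
    "\<And>i j. i \<in> J \<Longrightarrow> j \<in> J \<Longrightarrow> x i \<otimes> inv (x j) \<in> M"
proof -
  \<comment> \<open>\<open>D j g\<close> is an arbitrary exponent; only its residue modulo
    \<open>p\<close> is determined, as \<open>uniq\<close> shows. Congruences of natural numbers
    stand in for the group Z/p.\<close>
  define D :: "'c \<Rightarrow> 'a \<Rightarrow> nat" where "D j g = (SOME a. \<exists>l\<in>N j. g = l \<otimes> x j [^] a)" for j g
  have Nsub: "subgroup (N j) G" if "j \<in> J" for j using N[OF that] by (simp add: normal_in_def)
  have Nc: "l \<in> carrier G" if "l \<in> N j" "j \<in> J" for l j
    using that subgroup.subset[OF Nsub] by blast
  have D: "\<exists>l\<in>N j. g = l \<otimes> x j [^] D j g" if "j \<in> J" "g \<in> carrier G" for j g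
    unfolding D_def
    by (rule someI_ex[of "\<lambda>a. \<exists>l\<in>N j. g = l \<otimes> x j [^] a"])
      (use generate_insert_in_powers[OF fin N[OF that(1)] x[OF that(1)], of g] gen that in blast)
  have uniq: "a mod p = b mod p" if j: "j \<in> J" and l: "l \<in> N j" "l' \<in> N j"
    and eq: "l \<otimes> x j [^] a = l' \<otimes> x j [^] b" for j l l' and a b :: nat
  proof -
    have *: "a mod p = b mod p" if "a \<le> b" "l \<in> N j" "l' \<in> N j"
      and eq: "l \<otimes> x j [^] a = l' \<otimes> x j [^] b" for l l' and a b :: nat
    proof -
      have c: "l \<in> carrier G" "l' \<in> carrier G" "x j \<in> carrier G" using that Nc j x by auto
      have "l \<otimes> x j [^] a = (l' \<otimes> x j [^] (b - a)) \<otimes> x j [^] a"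
        using that c by (simp add: m_assoc nat_pow_mult)
      then have e: "l = l' \<otimes> x j [^] (b - a)" using c by simp
      then have "x j [^] (b - a) = inv l' \<otimes> l" using c by (simp add: m_assoc[symmetric])
      then have "x j [^] (b - a) \<in> N j"
        using that Nsub[OF j] by (simp add: subgroup.m_closed subgroup.m_inv_closed)
      then have "p dvd b - a"
        using prime_dvd_exponent_in_subgroup[OF p Nsub[OF j] x[OF j] notin[OF j] pow[OF j]] by blast
      then show ?thesis using that(1) by (metis mod_eq_dvd_iff_nat)
    qed
    show ?thesis
    proof (cases "a \<le> b")
      case True then show ?thesis using *[of a b l l'] l eq by auto
    next
      case False then show ?thesis using *[of b a l' l] l eq by auto
    qed
  qed
  have Deq: "D j g mod p = a mod p"
    if j: "j \<in> J" and l: "l \<in> N j" and g: "g = l \<otimes> x j [^] a" for j g l and a :: nat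
  proof -
    have "g \<in> carrier G" using g Nc[OF l j] x[OF j] by auto
    then obtain l' where "l' \<in> N j" "g = l' \<otimes> x j [^] D j g" using D[OF j] by blast
    then show ?thesis using uniq[OF j, of l' l] l g by auto
  qed
  have Dmult: "D j (g \<otimes> h) mod p = (D j g + D j h) mod p"
    if j: "j \<in> J" and g: "g \<in> carrier G" and h: "h \<in> carrier G" for j g h
  proof -
    obtain l1 l2 where l: "l1 \<in> N j" "g = l1 \<otimes> x j [^] D j g" "l2 \<in> N j" "h = l2 \<otimes> x j [^] D j h"
      using D[OF j g] D[OF j h] by blast
    have c: "l1 \<in> carrier G" "l2 \<in> carrier G" "x j \<in> carrier G" using l Nc j x by auto
    define y where "y = x j [^] D j g"
    have yc: "y \<in> carrier G" using c by (simp add: y_def)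
    have m: "l1 \<otimes> (y \<otimes> l2 \<otimes> inv y) \<in> N j"
      using N[OF j] l yc by (auto simp: normal_in_def intro: subgroup.m_closed)
    have "g \<otimes> h = l1 \<otimes> y \<otimes> (l2 \<otimes> x j [^] D j h)" using l by (simp add: y_def)
    also have "\<dots> = l1 \<otimes> y \<otimes> l2 \<otimes> (inv y \<otimes> y) \<otimes> x j [^] D j h"
      using c yc by (simp add: m_assoc)
    also have "\<dots> = (l1 \<otimes> (y \<otimes> l2 \<otimes> inv y)) \<otimes> (y \<otimes> x j [^] D j h)"
      using c yc by (simp only: m_assoc m_closed inv_closed nat_pow_closed)
    also have "y \<otimes> x j [^] D j h = x j [^] (D j g + D j h)"
      using c by (simp add: y_def nat_pow_mult)
    finally show ?thesis using Deq[OF j m] by blast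
  qed
  define f where "f g = (\<Sum>j\<in>J. D j g)" for g
  have fmult: "f (g \<otimes> h) mod p = (f g + f h) mod p"
    if "g \<in> carrier G" "h \<in> carrier G" for g h
  proof -
    have "f (g \<otimes> h) mod p = (\<Sum>j\<in>J. D j (g \<otimes> h) mod p) mod p"
      by (simp add: f_def mod_sum_eq)
    also have "(\<Sum>j\<in>J. D j (g \<otimes> h) mod p) = (\<Sum>j\<in>J. (D j g + D j h) mod p)"
      using Dmult that by (intro sum.cong) auto
    also have "\<dots> mod p = (f g + f h) mod p"
      by (simp add: f_def mod_sum_eq sum.distrib)
    finally show ?thesis .
  qed
  have D0: "D j g mod p = 0" if "j \<in> J" "g \<in> N j" for j g
    using Deq[of j g g 0] that Nc by simp
  have f0: "f g mod p = 0" if "g \<in> (\<Inter>j\<in>J. N j)" for g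
  proof -
    have "(\<Sum>j\<in>J. D j g mod p) = 0" using D0 that by simp
    then show ?thesis using mod_sum_eq[of "\<lambda>j. D j g" p J] by (simp add: f_def)
  qed
  have f1: "f (x i) mod p = 1" if i: "i \<in> J" for i
  proof -
    have p1: "1 mod p = 1" using p by (metis mod_less prime_gt_1_nat)
    have "D i (x i) mod p = 1 mod p"
      using Deq[OF i subgroup.one_closed[OF Nsub[OF i]], of "x i" 1] x[OF i] by simp
    then have "D j (x i) mod p = (if j = i then 1 else 0)" if "j \<in> J" for j
      using D0[OF that isin[OF i that]] p1 by auto
    then have "(\<Sum>j\<in>J. D j (x i) mod p) = 1" using J i by simp
    then show ?thesis using mod_sum_eq[of "\<lambda>j. D j (x i)" p J] p1 by (simp add: f_def)
  qed
  have fone: "f \<one> mod p = 0"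
    by (rule f0) (use Nsub in \<open>auto simp: subgroup.one_closed\<close>)
  \<comment> \<open>Inverses are expressed by a sum congruent to 0, which avoids subtraction of
    natural numbers.\<close>
  have finv: "(f g + f (inv g)) mod p = 0" if "g \<in> carrier G" for g
    using fmult[of g "inv g"] that fone by simp
  define M where "M = {g \<in> carrier G. p dvd f g}"
  have dvdm: "p dvd f (g \<otimes> h) \<longleftrightarrow> p dvd f g + f h" if "g \<in> carrier G" "h \<in> carrier G" for g h
    using fmult[OF that] by (simp add: dvd_eq_mod_eq_0)
  have dvdi: "p dvd f g + f (inv g)" if "g \<in> carrier G" for g
    using finv[OF that] by (simp add: dvd_eq_mod_eq_0)
  have Msub: "subgroup M G"
  proof
    show "\<one> \<in> M" using fone by (simp add: M_def dvd_eq_mod_eq_0)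
    show "inv g \<in> M" if "g \<in> M" for g
      using that dvdi[of g] by (auto simp: M_def dvd_add_right_iff)
  qed (auto simp: M_def dvdm)
  show thesis
  proof (rule that[of M])
    show "normal_in M (carrier G)"
      unfolding normal_in_def
    proof (intro conjI ballI)
      fix g h assume g: "g \<in> carrier G" and h: "h \<in> M"
      have hc: "h \<in> carrier G" "p dvd f h" using h by (auto simp: M_def)
      have "f (g \<otimes> h \<otimes> inv g) mod p = (f (g \<otimes> h) mod p + f (inv g)) mod p"
        using fmult[of "g \<otimes> h" "inv g"] g hc by (simp add: mod_add_left_eq)
      also have "\<dots> = ((f g + f h) mod p + f (inv g)) mod p" using fmult g hc by simp
      also have "\<dots> = (f g + f (inv g) + f h) mod p" by (simp only: mod_add_left_eq) (simp add: ac_simps)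
      also have "\<dots> = 0" using dvdi[OF g] hc(2) by (simp flip: dvd_eq_mod_eq_0)
      finally show "g \<otimes> h \<otimes> inv g \<in> M" using g hc by (simp add: M_def dvd_eq_mod_eq_0)
    qed (use Msub subgroup.subset subgroup_self in auto)
    show "M \<noteq> carrier G"
    proof
      assume "M = carrier G"
      moreover obtain i where "i \<in> J" using J by auto
      ultimately have "p dvd f (x i)" "f (x i) mod p = 1" using x f1 by (auto simp: M_def)
      then show False by (simp add: dvd_eq_mod_eq_0)
    qed
    show "(\<Inter>j\<in>J. N j) \<subseteq> M" using f0 Nc J by (force simp: M_def dvd_eq_mod_eq_0)
    show "x i \<otimes> inv (x j) \<in> M" if "i \<in> J" "j \<in> J" for i j
    proof -
      have "f (x i \<otimes> inv (x j)) mod p = (f (x i) mod p + f (inv (x j))) mod p"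
        using fmult x that by (simp add: mod_add_left_eq)
      also have "\<dots> = (f (x j) mod p + f (inv (x j))) mod p" using f1 that by simp
      also have "\<dots> = 0" using finv x that by (simp add: mod_add_left_eq)
      finally show ?thesis using x that by (simp add: M_def dvd_eq_mod_eq_0)
    qed
  qed
qed

end

section \<open>Hamiltonian words\<close>

context group
begin

text \<open>With \<open>c\<close> the product of \<open>v s\<close>, the word
  \<open>(v s)^(n-1) v\<close> runs through the cosets \<open>c^i H\<close> one after another. Each
  is traversed by a copy of the path \<open>v\<close> of \<open>H\<close>, and \<open>s\<close>
  steps to the next one.\<close>

lemma ham_word_extend:
  assumes fin: "finite (carrier G)" and nor: "normal_in H K" and s: "s \<in> K"
    and gen: "generate G (insert s H) = K" and T: "T \<subseteq> H" and v: "ham_word H T v"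
  shows "\<exists>w. ham_word K (insert s T) w"
proof -
  have sub: "subgroup H G" "subgroup K G" "H \<subseteq> K" using nor by (auto simp: normal_in_def)
  note car = subgroup.subset[OF sub(1)] subgroup.subset[OF sub(2)]
  have sc: "s \<in> carrier G" using s car by auto
  have vH: "set v \<subseteq> H" using v T by (auto simp: ham_word_def)
  have vc: "set v \<subseteq> carrier G" using vH car by auto
  have listH: "list_mult xs \<in> H" if "set xs \<subseteq> H" for xs
    using that sub(1) by (induction xs) (auto simp: subgroup.one_closed subgroup.m_closed)
  define c where "c = list_mult (v @ [s])"
  have c: "c = list_mult v \<otimes> s" using vc sc by (simp add: c_def list_mult_append)
  have vin: "list_mult v \<in> H" using listH vH by blast
  have cK: "c \<in> K" unfolding c using vin sub s by (auto intro: subgroup.m_closed)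
  \<comment> \<open>\<open>c\<close> and \<open>s\<close> differ by a factor in \<open>H\<close>, so
    \<open>c\<close> also generates \<open>K\<close> over \<open>H\<close>.\<close>
  have genc: "generate G (insert c H) = K"
  proof
    show "generate G (insert c H) \<subseteq> K"
      by (rule generate_subgroup_incl) (use cK sub in auto)
    have sg: "subgroup (generate G (insert c H)) G"
      by (rule generate_is_subgroup) (use cK car in auto)
    have "s = inv (list_mult v) \<otimes> c"
      unfolding c using vin car sc by (simp add: m_assoc[symmetric] subset_iff)
    moreover have "inv (list_mult v) \<in> H" using vin sub by (simp add: subgroup.m_inv_closed)
    ultimately have "s \<in> generate G (insert c H)" by (metis generate.eng generate.incl insertCI)
    then show "K \<subseteq> generate G (insert c H)"
      unfolding gen[symmetric] by (intro generate_subgroup_incl sg) (auto intro: generate.incl)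
  qed
  obtain n :: nat where n: "n > 0" "c [^] n \<in> H" "n * card H = card K"
    "\<And>g. g \<in> K \<Longrightarrow> \<exists>l\<in>H. \<exists>i<n. g = c [^] i \<otimes> l"
    using cyclic_extension[OF fin nor cK genc] by metis
  define B where "B i = concat (replicate i (v @ [s]))" for i
  \<comment> \<open>The last copy of \<open>v\<close> is not followed by \<open>s\<close>, so that
    the length stays below \<open>card K\<close>.\<close>
  define w where "w = B (n - 1) @ v"
  have Bset: "set (B i) \<subseteq> insert s (set v)" for i by (auto simp: B_def)
  have Bmult: "list_mult (B i) = c [^] i" for i
    unfolding B_def c_def by (rule list_mult_concat_replicate) (use vc sc in auto)
  have Bpre: "\<exists>ys. w = B i @ v @ ys" if "i < n" for i
  proof -
    have "n - 1 = i + (n - 1 - i)" using that by simp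
    then have "B (n - 1) = B i @ B (n - 1 - i)"
      unfolding B_def by (metis concat_append replicate_add)
    moreover have "\<exists>ys. B m @ v = v @ ys" for m by (cases m) (auto simp: B_def)
    ultimately show ?thesis by (auto simp: w_def)
  qed
  have "ham_word K (insert s T) w"
    unfolding ham_word_def
  proof (intro conjI ballI)
    show "set w \<subseteq> insert s T" using Bset v unfolding w_def ham_word_def by fastforce
    have "length (B i) = i * Suc (length v)" for i by (induction i) (auto simp: B_def)
    then have "length w < n * Suc (length v)" using n(1) by (cases n) (auto simp: w_def)
    also have "\<dots> \<le> n * card H" using v unfolding ham_word_def by (intro mult_le_mono2) auto
    finally show "length w < card K" using n by simp
    fix g assume "g \<in> K"
    then obtain l i where l: "l \<in> H" "i < n" "g = c [^] i \<otimes> l" using n by blast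
    then obtain xs ys where xs: "v = xs @ ys" "l = list_mult xs"
      using v unfolding ham_word_def by blast
    obtain zs where zs: "w = B i @ v @ zs" using Bpre l by blast
    have "g = list_mult (B i @ xs)"
    proof -
      have "set (B i) \<subseteq> carrier G" using Bset[of i] vc sc by auto
      then show ?thesis using l xs vc Bmult by (simp add: list_mult_append)
    qed
    then show "\<exists>xs ys. w = xs @ ys \<and> g = list_mult xs"
      using zs xs by (metis append.assoc)
  qed
  then show ?thesis by blast
qed

text \<open>
  Starting the walk with \<open>w\<close> instead of \<open>s # w\<close> puts all the arcs of \<open>S\<close> that may vary
  at the junctions between successive copies of \<open>w\<close>.
\<close>

lemma ham_word_skewed_generators:
  assumes fin: "finite (carrier G)" and M: "subgroup M G" and S: "S \<subseteq> carrier G"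
    and w: "set (s # w) \<subseteq> S" and wM: "list_mult (s # w) \<in> M"
    and len: "length (s # w) * card M = order G"
    and cov: "\<And>g. g \<in> carrier G \<Longrightarrow> \<exists>h\<in>M. \<exists>j<length (s # w). g = h \<otimes> list_mult (take j (s # w))"
    and v: "ham_word M ((\<lambda>t. t \<otimes> list_mult w) ` S) v"
  shows "\<exists>w'. ham_word (carrier G) S w'"
proof -
  have wc: "set w \<subseteq> carrier G" "s \<in> carrier G" using w S by auto
  define c where "c = list_mult w"
  have cc: "c \<in> carrier G" using wc by (simp add: c_def)
  have "v \<in> lists ((\<lambda>t. t \<otimes> c) ` S)"
    using v by (auto simp: ham_word_def c_def)
  then obtain ts where ts: "set ts \<subseteq> S" "v = map (\<lambda>t. t \<otimes> c) ts"
    unfolding lists_image by (auto simp: in_lists_conv_set)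
  \<comment> \<open>After the initial \<open>w\<close>, each block \<open>t # w\<close> multiplies
    by one of the skewed generators \<open>t c\<close> of \<open>M\<close>.\<close>
  define B where "B us = w @ concat (map (\<lambda>t. t # w) us)" for us
  have Bset: "set (B us) \<subseteq> S" if "set us \<subseteq> S" for us using that w by (auto simp: B_def)
  have Bmult: "list_mult (B us) = c \<otimes> list_mult (map (\<lambda>t. t \<otimes> c) us)" if us: "set us \<subseteq> S" for us
  proof -
    have *: "set (concat (map (\<lambda>t. t # w) us)) \<subseteq> carrier G" if "set us \<subseteq> S" for us
      using that wc S by auto
    have "list_mult (concat (map (\<lambda>t. t # w) us)) = list_mult (map (\<lambda>t. t \<otimes> c) us)"
      using us
    proof (induction us)
      case (Cons t us)
      then have "t \<in> carrier G" "set (map (\<lambda>t. t \<otimes> c) us) \<subseteq> carrier G" using S cc by auto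
      then show ?case using Cons wc cc *[of us] by (simp add: list_mult_append m_assoc c_def)
    qed simp
    then show ?thesis using * us wc by (simp add: B_def list_mult_append c_def)
  qed
  have Bend: "\<exists>zs. B us = zs @ w" for us
  proof (induction us rule: rev_induct)
    case (snoc t us) then show ?case by (simp add: B_def)
  qed (simp add: B_def)
  have Bapp: "B (us @ us') = B us @ concat (map (\<lambda>t. t # w) us')" for us us'
    by (simp add: B_def)
  \<comment> \<open>From \<open>g\<close> the rest of the cycle leads to some \<open>h'\<close> in
    \<open>M\<close>. A prefix of \<open>v\<close> reaches \<open>h'\<close>, so \<open>c h'\<close>
    is the product of some \<open>B t1\<close>; deleting the final piece of its last
    \<open>w\<close> leaves a prefix of \<open>B ts\<close> with product \<open>c g\<close>.\<close>
  have reach: "\<exists>xs ys. B ts = xs @ ys \<and> c \<otimes> g = list_mult xs" if g: "g \<in> carrier G" for g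
  proof -
    obtain h j where h: "h \<in> M" "j \<le> length w" "g = h \<otimes> list_mult (take j (s # w))"
      using cov[OF g] by (metis length_Cons less_Suc_eq_le)
    have hc: "h \<in> carrier G" using h M subgroup.subset by blast
    \<comment> \<open>the coset of \<open>M\<close> itself is moved from the start of the cycle to its end\<close>
    have "\<exists>us. \<exists>h'\<in>M. g \<otimes> list_mult us = h' \<and> (\<exists>zs. w = zs @ us)"
    proof (cases j)
      case 0
      then show ?thesis using h hc by (intro exI[of _ "[]"] bexI[of _ h]) auto
    next
      case (Suc i)
      have a: "set (take i w) \<subseteq> carrier G" "set (drop i w) \<subseteq> carrier G"
        using wc set_take_subset[of i w] set_drop_subset[of i w] by auto
      have "g \<otimes> list_mult (drop i w) = h \<otimes> list_mult (s # w)"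
        using h Suc hc wc a list_mult_append[OF a] by (simp add: m_assoc)
      then show ?thesis using h wM M
        by (intro exI[of _ "drop i w"] bexI[of _ "h \<otimes> list_mult (s # w)"])
          (auto simp: subgroup.m_closed intro: exI[of _ "take i w"])
    qed
    then obtain us h' zs where u: "h' \<in> M" "g \<otimes> list_mult us = h'" "w = zs @ us" by blast
    obtain xs ys where xs: "v = xs @ ys" "h' = list_mult xs"
      using v u(1) unfolding ham_word_def by blast
    obtain t1 t2 where t: "ts = t1 @ t2" "xs = map (\<lambda>t. t \<otimes> c) t1"
      using ts(2) xs(1) by (metis map_eq_append_conv)
    obtain zs' where zs': "B t1 = zs' @ w" using Bend by blast
    have cr: "set us \<subseteq> carrier G" "set zs \<subseteq> carrier G" "set zs' \<subseteq> carrier G"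
      using u(3) wc Bset[of t1] t ts S zs' by auto
    have "c \<otimes> h' = list_mult (B t1)" using Bmult t ts xs by simp
    also have "\<dots> = list_mult (zs' @ zs) \<otimes> list_mult us"
      using zs' u(3) cr by (simp add: list_mult_append m_assoc)
    finally have "c \<otimes> g \<otimes> list_mult us = list_mult (zs' @ zs) \<otimes> list_mult us"
      using u(2) cc g cr by (simp add: m_assoc)
    then have "c \<otimes> g = list_mult (zs' @ zs)" using cc g cr by simp
    moreover have "B ts = (zs' @ zs) @ us @ concat (map (\<lambda>t. t # w) t2)"
      using Bapp[of t1 t2] t zs' u(3) by simp
    ultimately show ?thesis by blast
  qed
  have "ham_word (carrier G) S (B ts)"
    unfolding ham_word_def
  proof (intro conjI ballI)
    show "set (B ts) \<subseteq> S" using Bset ts by blast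
    have "length (B ts) = length w + length ts * Suc (length w)"
      by (induction ts) (auto simp: B_def)
    \<comment> \<open>The first copy of \<open>w\<close> lacks a leading letter, which makes the
      inequality strict.\<close>
    then have "length (B ts) < Suc (length ts) * Suc (length w)" by simp
    also have "\<dots> \<le> card M * Suc (length w)"
      using v ts unfolding ham_word_def by (intro mult_le_mono1) auto
    finally show "length (B ts) < card (carrier G)" using len by (simp add: order_def mult.commute)
    fix g assume "g \<in> carrier G"
    then show "\<exists>xs ys. B ts = xs @ ys \<and> g = list_mult xs"
      using reach[of "inv c \<otimes> g"] cc by (simp add: m_assoc[symmetric])
  qed
  then show ?thesis by blast
qed

end

section \<open>Hamiltonian cycles in coset digraphs\<close>

definition (in group) walk :: "('a \<Rightarrow> 'a) \<Rightarrow> nat \<Rightarrow> 'a"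
  where "walk r j = ((\<lambda>g. g \<otimes> r g) ^^ j) \<one>"

text \<open>A function on the coset space \<open>K\G\<close> is encoded as a left \<open>K\<close>-invariant function on \<open>G\<close>.\<close>

definition (in group) left_invariant :: "'a set \<Rightarrow> ('a \<Rightarrow> 'c) \<Rightarrow> bool"
  where "left_invariant K f \<longleftrightarrow> (\<forall>h\<in>K. \<forall>g\<in>carrier G. f (h \<otimes> g) = f g)"

text \<open>Modulo \<open>K\<close> the vertices \<open>walk r j\<close> with \<open>j < n\<close>
  form a hamiltonian cycle: they meet every right coset, \<open>n\<close> is the index of
  \<open>K\<close>, and the walk is back in \<open>K\<close> after \<open>n\<close> steps. The
  element \<open>walk r n\<close> is the product around the cycle; it decides whether the cycle
  lifts to a smaller subgroup.\<close>

definition (in group) coset_cycle :: "'a set \<Rightarrow> ('a \<Rightarrow> 'a) \<Rightarrow> nat \<Rightarrow> bool"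
  where "coset_cycle K r n \<longleftrightarrow> subgroup K G \<and> (\<forall>g\<in>carrier G. r g \<in> carrier G) \<and>
    left_invariant K r \<and> walk r n \<in> K \<and> n * card K = order G \<and>
    (\<forall>g\<in>carrier G. \<exists>h\<in>K. \<exists>j<n. g = h \<otimes> walk r j)"

context group
begin

lemma walk_0 [simp]: "walk r 0 = \<one>"
  and walk_Suc: "walk r (Suc j) = walk r j \<otimes> r (walk r j)"
  by (simp_all add: walk_def)

lemma walk_closed: "(\<And>g. g \<in> carrier G \<Longrightarrow> r g \<in> carrier G) \<Longrightarrow> walk r j \<in> carrier G"
  by (induction j) (auto simp: walk_Suc)

lemma left_invariantD: "left_invariant K f \<Longrightarrow> h \<in> K \<Longrightarrow> g \<in> carrier G \<Longrightarrow> f (h \<otimes> g) = f g"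
  by (simp add: left_invariant_def)

lemma left_invariant_mono: "left_invariant K f \<Longrightarrow> L \<subseteq> K \<Longrightarrow> left_invariant L f"
  by (auto simp: left_invariant_def)

lemma coset_cycleD:
  assumes "coset_cycle K r n"
  shows "subgroup K G" "\<And>g. g \<in> carrier G \<Longrightarrow> r g \<in> carrier G" "left_invariant K r"
    "walk r n \<in> K" "n * card K = order G"
    "\<And>g. g \<in> carrier G \<Longrightarrow> \<exists>h\<in>K. \<exists>j<n. g = h \<otimes> walk r j" "walk r j \<in> carrier G"
  using assms by (auto simp: coset_cycle_def intro: walk_closed)

text \<open>\<open>walk r n\<close> lies in \<open>K\<close>, under which \<open>r\<close> is
  invariant from the left; so every further lap uses the same generators again.\<close>

lemma coset_cycle_walk_add:
  assumes "coset_cycle K r n"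
  shows "walk r (n + j) = walk r n \<otimes> walk r j"
proof (induction j)
  case 0
  show ?case using coset_cycleD(7)[OF assms] by simp
next
  case (Suc j)
  note D = coset_cycleD[OF assms]
  show ?case
    using Suc D(2)[OF D(7)] D(7) left_invariantD[OF D(3,4)] by (simp add: walk_Suc m_assoc)
qed

lemma coset_cycle_walk_mult:
  assumes "coset_cycle K r n"
  shows "walk r (i * n + j) = walk r n [^] i \<otimes> walk r j"
proof (induction i)
  case (Suc i)
  note D = coset_cycleD[OF assms]
  have "walk r (Suc i * n + j) = walk r n \<otimes> (walk r n [^] i \<otimes> walk r j)"
    using coset_cycle_walk_add[OF assms, of "i * n + j"] Suc by (simp add: add.assoc)
  also have "\<dots> = walk r n [^] Suc i \<otimes> walk r j"
    using D(7) nat_pow_Suc2[of "walk r n" i] by (simp add: m_assoc)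
  finally show ?case .
qed (use coset_cycleD(7)[OF assms] in simp)

text \<open>\<open>K/L\<close> is cyclic, generated by the class of the product around the cycle.
  Its powers distinguish the laps, so after as many laps as the index of \<open>L\<close> in
  \<open>K\<close> every coset of \<open>L\<close> has been met once.\<close>

lemma coset_cycle_refine:
  assumes fin: "finite (carrier G)" and cyc: "coset_cycle K r n" and nor: "normal_in L K"
    and gen: "generate G (insert (walk r n) L) = K"
  shows "\<exists>m. coset_cycle L r m"
proof -
  note D = coset_cycleD[OF cyc]
  have sub: "subgroup L G" "L \<subseteq> K" using nor by (auto simp: normal_in_def)
  obtain i :: nat where i: "i > 0" "walk r n [^] i \<in> L" "i * card L = card K"
    "\<And>g. g \<in> K \<Longrightarrow> \<exists>l\<in>L. \<exists>j<i. g = l \<otimes> walk r n [^] j"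
    using cyclic_extension[OF fin nor D(4) gen] by metis
  have "coset_cycle L r (i * n)"
    unfolding coset_cycle_def
  proof (intro conjI ballI)
    show "walk r (i * n) \<in> L"
      using coset_cycle_walk_mult[OF cyc, of i 0] i D(7) by simp
    show "i * n * card L = order G" using i(3) D(5) by (metis mult.assoc mult.commute)
    show "left_invariant L r" by (rule left_invariant_mono[OF D(3) sub(2)])
    fix g assume g: "g \<in> carrier G"
    then obtain h j where h: "h \<in> K" "j < n" "g = h \<otimes> walk r j" using D(6) by blast
    obtain l a where l: "l \<in> L" "a < i" "h = l \<otimes> walk r n [^] a" using i(4) h(1) by blast
    have "g = l \<otimes> walk r (a * n + j)"
      using h l D(7) sub subgroup.mem_carrier[OF sub(1) l(1)]
      by (simp add: coset_cycle_walk_mult[OF cyc] m_assoc)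
    moreover have "a * n + j < i * n"
    proof -
      have "a * n + j < Suc a * n" using h by simp
      also have "\<dots> \<le> i * n" using l by (intro mult_le_mono1) simp
      finally show ?thesis .
    qed
    ultimately show "\<exists>h\<in>L. \<exists>j<i * n. g = h \<otimes> walk r j" using l by blast
  qed (use sub D in auto)
  then show ?thesis by blast
qed

text \<open>At every \<open>g\<close> the generators \<open>r g\<close> and \<open>r' g\<close> lead
  to the same right coset of \<open>K\<close>, so the two walks pass through the same cosets in the
  same order.\<close>

lemma coset_cycle_switch:
  assumes cyc: "coset_cycle K r n" and r': "\<And>g. g \<in> carrier G \<Longrightarrow> r' g \<in> carrier G"
    and inv: "left_invariant K r'"
    and K: "\<And>g. g \<in> carrier G \<Longrightarrow> g \<otimes> r' g \<otimes> inv (r g) \<otimes> inv g \<in> K"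
  shows "coset_cycle K r' n"
proof -
  note D = coset_cycleD[OF cyc]
  note [simp] = D(7) walk_closed[of r', OF r']
  have walk: "\<exists>h\<in>K. walk r' j = h \<otimes> walk r j" for j
  proof (induction j)
    case 0
    show ?case using D(1) by (intro bexI[of _ \<one>]) (auto simp: subgroup.one_closed)
  next
    case (Suc j)
    then obtain h where h: "h \<in> K" "walk r' j = h \<otimes> walk r j" by blast
    let ?g = "walk r j"
    let ?x = "?g \<otimes> r' ?g \<otimes> inv (r ?g) \<otimes> inv ?g"
    have c: "h \<in> carrier G" "r ?g \<in> carrier G" "r' ?g \<in> carrier G"
      using h D r' by (auto simp: subgroup.mem_carrier)
    have "walk r' (Suc j) = h \<otimes> ?g \<otimes> r' ?g"
      using h left_invariantD[OF inv h(1), of ?g] by (simp add: walk_Suc)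
    also have "\<dots> = h \<otimes> ?g \<otimes> r' ?g \<otimes> (inv (r ?g) \<otimes> (inv ?g \<otimes> ?g) \<otimes> r ?g)" using c by simp
    also have "\<dots> = (h \<otimes> ?x) \<otimes> walk r (Suc j)"
      using c by (simp only: walk_Suc m_assoc m_closed inv_closed D(7))
    finally show ?case using h K[of ?g] D(1) by (auto intro: subgroup.m_closed)
  qed
  show ?thesis
    unfolding coset_cycle_def
  proof (intro conjI ballI)
    show "walk r' n \<in> K" using walk[of n] D(1,4) by (auto intro: subgroup.m_closed)
    fix g assume g: "g \<in> carrier G"
    then obtain h j where h: "h \<in> K" "j < n" "g = h \<otimes> walk r j" using D(6) by blast
    obtain h' where h': "h' \<in> K" "walk r' j = h' \<otimes> walk r j" using walk by blast
    have c: "h \<in> carrier G" "h' \<in> carrier G" using h h' D(1) by (auto simp: subgroup.mem_carrier)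
    have "g = (h \<otimes> inv h') \<otimes> walk r' j"
      using h h' c by (simp add: m_assoc) (simp add: m_assoc[symmetric])
    moreover have "h \<otimes> inv h' \<in> K"
      using h(1) h'(1) D(1) by (simp add: subgroup.m_closed subgroup.m_inv_closed)
    ultimately show "\<exists>h\<in>K. \<exists>j<n. g = h \<otimes> walk r' j" using h(2) by blast
  qed (use D r' inv in auto)
qed

text \<open>The cosets met cover \<open>G\<close>, and \<open>n * card K = order G\<close> leaves no
  room for meeting one twice.\<close>

lemma coset_cycle_distinct:
  assumes fin: "finite (carrier G)" and cyc: "coset_cycle K r n"
    and ij: "i < n" "j < n" "walk r i \<otimes> inv (walk r j) \<in> K"
  shows "i = j"
proof -
  note D = coset_cycleD[OF cyc]
  let ?f = "\<lambda>(h, j). h \<otimes> walk r j"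
  have finK: "finite K" using fin D(1) by (meson finite_subset subgroup.subset)
  have "?f ` (K \<times> {..<n}) = carrier G"
  proof
    show "carrier G \<subseteq> ?f ` (K \<times> {..<n})" using D(6) by force
  qed (use D in \<open>auto simp: subgroup.mem_carrier\<close>)
  moreover have "card (K \<times> {..<n}) = card (carrier G)"
    using D(5) by (simp add: card_cartesian_product order_def mult.commute)
  ultimately have "inj_on ?f (K \<times> {..<n})"
    by (intro eq_card_imp_inj_on) (use finK in auto)
  moreover have "?f (\<one>, i) = ?f (walk r i \<otimes> inv (walk r j), j)"
    using D(7) by (simp add: m_assoc)
  moreover have "(\<one>, i) \<in> K \<times> {..<n}" "(walk r i \<otimes> inv (walk r j), j) \<in> K \<times> {..<n}"
    using ij D(1) by (auto simp: subgroup.one_closed)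
  ultimately have "(\<one>, i) = (walk r i \<otimes> inv (walk r j), j)" by (rule inj_onD)
  then show ?thesis by simp
qed

lemma list_mult_walk:
  assumes "\<And>g. g \<in> carrier G \<Longrightarrow> r g \<in> carrier G"
  shows "list_mult (map (\<lambda>j. r (walk r j)) [0..<n]) = walk r n"
proof (induction n)
  case (Suc n)
  have "set (map (\<lambda>j. r (walk r j)) [0..<n]) \<subseteq> carrier G" "r (walk r n) \<in> carrier G"
    using assms walk_closed[OF assms] by auto
  then show ?case using Suc by (simp add: list_mult_append walk_Suc)
qed simp

section \<open>Calculations with relatively normal subgroups\<close>

lemma generate_normal_in:
  assumes K: "subgroup K G" and X: "X \<subseteq> K"
    and conj: "\<And>g x. g \<in> K \<Longrightarrow> x \<in> X \<Longrightarrow> g \<otimes> x \<otimes> inv g \<in> X"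
  shows "normal_in (generate G X) K"
proof -
  note Kc = subgroup.mem_carrier[OF K]
  have X': "X \<subseteq> carrier G" using X Kc by auto
  have sub: "generate G X \<subseteq> K" by (rule generate_subgroup_incl[OF X K])
  have "g \<otimes> x \<otimes> inv g \<in> generate G X" if g: "g \<in> K" and x: "x \<in> generate G X" for g x
    using x
  proof induction
    case one
    show ?case using Kc[OF g] by (simp add: generate.one)
  next
    case (incl h)
    then show ?case using conj[OF g] by (blast intro: generate.incl)
  next
    case (inv h)
    have "g \<otimes> inv h \<otimes> inv g = inv (g \<otimes> h \<otimes> inv g)"
      using X' inv Kc[OF g] by (simp add: inv_mult_group m_assoc subset_iff)
    then show ?case using conj[OF g inv] by (simp add: generate.inv)
  next
    case (eng h1 h2)
    have c: "h1 \<in> carrier G" "h2 \<in> carrier G" using eng generate_in_carrier[OF X'] by auto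
    have "g \<otimes> (h1 \<otimes> h2) \<otimes> inv g = g \<otimes> h1 \<otimes> (inv g \<otimes> g) \<otimes> h2 \<otimes> inv g"
      using c Kc[OF g] by (simp add: m_assoc)
    also have "\<dots> = (g \<otimes> h1 \<otimes> inv g) \<otimes> (g \<otimes> h2 \<otimes> inv g)"
      using c Kc[OF g] by (simp only: m_assoc m_closed inv_closed)
    finally show ?case using eng.IH by (simp add: generate.eng)
  qed
  then show ?thesis using K sub generate_is_subgroup[OF X'] by (simp add: normal_in_def)
qed

text \<open>Modulo \<open>N\<close> the factor \<open>y\<close> vanishes. The induction moves it to
  the front, where its conjugates accumulate in \<open>N\<close>.\<close>

lemma normal_in_pow_mult:
  assumes nor: "normal_in N K" and x: "x \<in> K" and y: "y \<in> N" and q: "x [^] (q::nat) \<in> N"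
  shows "(x \<otimes> y) [^] q \<in> N"
proof -
  have sub: "subgroup N G" "subgroup K G" using nor by (auto simp: normal_in_def)
  have c: "x \<in> carrier G" "y \<in> carrier G"
    using x y sub by (auto simp: subgroup.mem_carrier)
  have "\<exists>z\<in>N. (x \<otimes> y) [^] i = z \<otimes> x [^] (i::nat)" for i
  proof (induction i)
    case 0
    show ?case using sub by (intro bexI[of _ \<one>]) (auto simp: subgroup.one_closed)
  next
    case (Suc i)
    then obtain z where z: "z \<in> N" "(x \<otimes> y) [^] i = z \<otimes> x [^] i" by blast
    have zc: "z \<in> carrier G" using z sub by (auto simp: subgroup.mem_carrier)
    define w where "w = x [^] Suc i"
    have wc: "w \<in> carrier G" using c by (simp add: w_def)
    have "x [^] j \<in> K" for j :: nat
      using x sub(2) by (induction j) (auto simp: subgroup.one_closed subgroup.m_closed)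
    then have wK: "w \<in> K" unfolding w_def by blast
    have "(x \<otimes> y) [^] Suc i = z \<otimes> w \<otimes> y \<otimes> (inv w \<otimes> w)"
      using z c zc wc by (simp add: w_def m_assoc)
    also have "\<dots> = (z \<otimes> (w \<otimes> y \<otimes> inv w)) \<otimes> w"
      using c zc wc by (simp only: m_assoc m_closed inv_closed)
    finally have "(x \<otimes> y) [^] Suc i = (z \<otimes> (w \<otimes> y \<otimes> inv w)) \<otimes> x [^] Suc i" by (simp add: w_def)
    moreover have "z \<otimes> (w \<otimes> y \<otimes> inv w) \<in> N"
      using nor wK y z sub by (auto simp: normal_in_def intro: subgroup.m_closed)
    ultimately show ?case by blast
  qed
  then show ?thesis using q sub by (metis subgroup.m_closed)
qed

end

section \<open>Central extensions of p-groups\<close>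

context group
begin

section \<open>Subgroups as groups in their own right\<close>

lemma normal_in_restrict:
  assumes K: "subgroup K G" and nor: "group.normal_in (G\<lparr>carrier := K\<rparr>) N K"
  shows "normal_in N K"
proof -
  interpret K: group "G\<lparr>carrier := K\<rparr>" using K by (rule subgroup_imp_group)
  have "subgroup N G" using K nor incl_subgroup by (auto simp: K.normal_in_def)
  moreover have "inv\<^bsub>G\<lparr>carrier := K\<rparr>\<^esub> g = inv g" if "g \<in> K" for g
    using K that by (rule m_inv_consistent)
  ultimately show ?thesis using K nor by (auto simp: K.normal_in_def normal_in_def)
qed

lemma normal_in_restrictI:
  assumes nor: "normal_in N K"
  shows "group.normal_in (G\<lparr>carrier := K\<rparr>) N K"
proof -
  have K: "subgroup K G" "subgroup N G" "N \<subseteq> K" using nor by (auto simp: normal_in_def)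
  interpret K: group "G\<lparr>carrier := K\<rparr>" using K(1) by (rule subgroup_imp_group)
  have "subgroup N (G\<lparr>carrier := K\<rparr>)" using K by (simp add: subgroup_incl)
  moreover have "inv\<^bsub>G\<lparr>carrier := K\<rparr>\<^esub> g = inv g" if "g \<in> K" for g
    using K(1) that by (rule m_inv_consistent)
  moreover have "subgroup K (G\<lparr>carrier := K\<rparr>)" using K.subgroup_self by simp
  ultimately show ?thesis using K nor by (auto simp: K.normal_in_def normal_in_def)
qed

lemma pow_restrict: "x [^]\<^bsub>G\<lparr>carrier := K\<rparr>\<^esub> (n::nat) = x [^] n"
  by (simp add: nat_pow_def)

lemma list_mult_restrict: "monoid.list_mult (G\<lparr>carrier := K\<rparr>) xs = list_mult xs"
  if "subgroup K G"
proof -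
  interpret K: group "G\<lparr>carrier := K\<rparr>" using that by (rule subgroup_imp_group)
  show ?thesis by (simp add: K.list_mult_def list_mult_def)
qed

lemma ham_word_restrict: "group.ham_word (G\<lparr>carrier := K\<rparr>) H S w = ham_word H S w"
  if "subgroup K G"
proof -
  interpret K: group "G\<lparr>carrier := K\<rparr>" using that by (rule subgroup_imp_group)
  show ?thesis using that by (simp add: K.ham_word_def ham_word_def list_mult_restrict)
qed

end

text \<open>The image of \<open>\<pi>\<close> may be any subgroup of \<open>P\<close>, so every
  subgroup of \<open>G\<close> inherits the structure with the same \<open>P\<close>,
  \<open>p\<close> and \<open>k\<close>.\<close>

locale p_group_central_extension = group_hom G P \<pi>
  for G (structure) and P (structure) and \<pi> +
  fixes p k :: nat
  assumes finite_carrier: "finite (carrier G)" and prime_p: "prime p" and order_P: "order P = p ^ k"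
    and central: "\<And>x y. x \<in> kernel G P \<pi> \<Longrightarrow> y \<in> carrier G \<Longrightarrow> x \<otimes> y = y \<otimes> x"
begin

lemma restrict: "p_group_central_extension (G\<lparr>carrier := K\<rparr>) P \<pi> p k" if K: "subgroup K G"
proof -
  have sub: "K \<subseteq> carrier G" using K by (rule subgroup.subset)
  interpret K: group "G\<lparr>carrier := K\<rparr>" using K by (rule G.subgroup_imp_group)
  show ?thesis
  proof unfold_locales
    show "\<pi> \<in> hom (G\<lparr>carrier := K\<rparr>) P"
      using sub by (auto simp: hom_def subset_iff)
    show "finite (carrier (G\<lparr>carrier := K\<rparr>))"
      using sub finite_carrier finite_subset by auto
    show "x \<otimes>\<^bsub>G\<lparr>carrier := K\<rparr>\<^esub> y = y \<otimes>\<^bsub>G\<lparr>carrier := K\<rparr>\<^esub> x"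
      if "x \<in> kernel (G\<lparr>carrier := K\<rparr>) P \<pi>" "y \<in> carrier (G\<lparr>carrier := K\<rparr>)" for x y
      using that sub central[of x y] by (auto simp: kernel_def)
  qed (use prime_p order_P in auto)
qed

lemma kernelI: "x \<in> carrier G \<Longrightarrow> \<pi> x = \<one>\<^bsub>P\<^esub> \<Longrightarrow> x \<in> kernel G P \<pi>"
  by (simp add: kernel_def)

lemma pow_order_in_kernel: "x \<in> carrier G \<Longrightarrow> x [^] (p ^ k) \<in> kernel G P \<pi>"
  using H.pow_order_eq_1[of "\<pi> x"] order_P by (simp add: kernel_def hom_nat_pow)

text \<open>\<open>p^k\<close>-th powers lie in the central kernel, so conjugation does not move
  them.\<close>

lemma conj_pow_order:
  assumes g: "g \<in> carrier G" and x: "x \<in> carrier G"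
  shows "(g \<otimes> x \<otimes> inv g) [^] (p ^ k) = x [^] (p ^ k)"
proof -
  have "(g \<otimes> x \<otimes> inv g) [^] i = g \<otimes> x [^] i \<otimes> inv g" for i :: nat
  proof (induction i)
    case (Suc i)
    have "(g \<otimes> x \<otimes> inv g) [^] Suc i = (g \<otimes> x [^] i \<otimes> inv g) \<otimes> (g \<otimes> x \<otimes> inv g)"
      using Suc by simp
    also have "\<dots> = g \<otimes> x [^] i \<otimes> (inv g \<otimes> g) \<otimes> x \<otimes> inv g"
      using g x by (simp only: G.m_assoc G.m_closed G.inv_closed G.nat_pow_closed)
    finally show ?case using g x by (simp add: G.m_assoc)
  qed (use g in simp)
  moreover have "x [^] (p ^ k) \<otimes> g = g \<otimes> x [^] (p ^ k)"
    using central[OF pow_order_in_kernel[OF x] g] .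
  ultimately show ?thesis using g x by (metis G.inv_solve_right G.m_closed G.nat_pow_closed)
qed

text \<open>If \<open>R\<close> and \<open>G\<close> have the same image under \<open>\<pi>\<close>,
  then \<open>G\<close> is \<open>R\<close> times the central kernel, and conjugation by
  \<open>G\<close> reduces to conjugation by \<open>R\<close>. Otherwise the image of
  \<open>R\<close> lies in a maximal, hence normal, subgroup of the image of \<open>G\<close>, a
  \<open>p\<close>-group; the preimage of that subgroup is proper and contains \<open>R\<close>, so
  it is \<open>R\<close>.\<close>

lemma maximal_subgroup_normal:
  assumes R: "subgroup R G"
    and max: "\<And>x. x \<in> carrier G - R \<Longrightarrow> generate G (insert x R) = carrier G"
  shows "G.normal_in R (carrier G)"
proof -
  note Rc = subgroup.mem_carrier[OF R]
  let ?Q = "\<pi> ` carrier G"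
  have Q: "subgroup ?Q P" by (rule img_is_subgroup)
  have "g \<otimes> x \<otimes> inv g \<in> R" if g: "g \<in> carrier G" and x: "x \<in> R" for g x
  proof (cases "\<pi> ` R = ?Q")
    case True
    then obtain r where r: "r \<in> R" "\<pi> r = \<pi> g" using g by (metis imageE imageI)
    define z where "z = inv r \<otimes> g"
    have zc: "z \<in> carrier G" using g r Rc by (simp add: z_def)
    have "z \<in> kernel G P \<pi>"
      using r g Rc zc by (intro kernelI) (auto simp: z_def)
    then have zx: "z \<otimes> x = x \<otimes> z" using central Rc x by blast
    have gz: "g = r \<otimes> z" using r Rc g by (simp add: z_def G.m_assoc[symmetric])
    have "g \<otimes> x \<otimes> inv g = r \<otimes> (z \<otimes> x) \<otimes> inv z \<otimes> inv r"
      using r Rc x zc by (simp add: gz G.inv_mult_group G.m_assoc)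
    also have "\<dots> = r \<otimes> x \<otimes> inv r"
      using r Rc x zc by (simp add: zx G.m_assoc)
    finally show ?thesis using r x R by (simp add: subgroup.m_closed subgroup.m_inv_closed)
  next
    case False
    interpret PQ: group "P\<lparr>carrier := ?Q\<rparr>" using Q by (rule H.subgroup_imp_group)
    have finQ: "finite ?Q" using finite_carrier by simp
    have piR: "subgroup (\<pi> ` R) P" by (rule subgroup_img_is_subgroup[OF R])
    then have "subgroup (\<pi> ` R) (P\<lparr>carrier := ?Q\<rparr>)"
      using Q Rc by (intro H.subgroup_incl) auto
    then obtain N where N: "subgroup N (P\<lparr>carrier := ?Q\<rparr>)" "\<pi> ` R \<subseteq> N" "N \<noteq> ?Q"
      "\<And>y. y \<in> ?Q - N \<Longrightarrow> generate (P\<lparr>carrier := ?Q\<rparr>) (insert y N) = ?Q"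
      using PQ.exists_maximal_subgroup[of "\<pi> ` R"] finQ False by auto
    have "card ?Q dvd p ^ k"
      using H.lagrange[OF Q] order_P by (metis dvd_triv_right)
    then obtain i where "card ?Q = p ^ i" using divides_primepow_nat[OF prime_p] by blast
    then have "order (P\<lparr>carrier := ?Q\<rparr>) = p ^ i" by (simp add: order_def)
    then have norm: "a \<otimes>\<^bsub>P\<^esub> b \<otimes>\<^bsub>P\<^esub> inv\<^bsub>P\<^esub> a \<in> N" if "a \<in> ?Q" "b \<in> N" for a b
      using PQ.p_group_maximal_subgroup_normal[OF prime_p _ N(1) _ _ that(2), of i a] N(4) that Q
      by (simp add: H.m_inv_consistent)
    have NP: "subgroup N P" using N(1) Q by (metis H.incl_subgroup)
    define R' where "R' = {x \<in> carrier G. \<pi> x \<in> N}"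
    have R': "subgroup R' G"
      by (unfold_locales) (use NP in \<open>auto simp: R'_def subgroup.m_closed subgroup.one_closed subgroup.m_inv_closed\<close>)
    have sub: "R \<subseteq> R'" using N(2) Rc by (auto simp: R'_def)
    have "R' \<noteq> carrier G"
    proof
      assume "R' = carrier G"
      then have "?Q \<subseteq> N" by (auto simp: R'_def)
      moreover have "N \<subseteq> ?Q" using N(1) subgroup.subset by fastforce
      ultimately show False using N(3) by auto
    qed
    have "R' = R"
    proof (rule ccontr)
      assume "R' \<noteq> R"
      then obtain y where y: "y \<in> R'" "y \<notin> R" using sub by auto
      then have "generate G (insert y R) = carrier G" using max by (auto simp: R'_def)
      moreover have "generate G (insert y R) \<subseteq> R'"
        by (rule G.generate_subgroup_incl) (use y sub R' in auto)
      ultimately show False using \<open>R' \<noteq> carrier G\<close> R' subgroup.subset by blast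
    qed
    moreover have "g \<otimes> x \<otimes> inv g \<in> R'"
      using g x sub norm[of "\<pi> g" "\<pi> x"] by (auto simp: R'_def)
    ultimately show ?thesis by simp
  qed
  then show ?thesis using R Rc G.subgroup_self by (auto simp: G.normal_in_def)
qed

lemma exists_maximal_normal:
  assumes K: "subgroup K G" and M: "subgroup M G" "M \<subseteq> K" "M \<noteq> K"
  obtains N where "G.normal_in N K" "M \<subseteq> N" "N \<noteq> K"
    "\<And>x. x \<in> K - N \<Longrightarrow> generate G (insert x N) = K"
proof -
  interpret K: p_group_central_extension "G\<lparr>carrier := K\<rparr>" P \<pi> p k by (rule restrict[OF K])
  have "subgroup M (G\<lparr>carrier := K\<rparr>)" using M K by (simp add: G.subgroup_incl)
  then obtain N where N: "subgroup N (G\<lparr>carrier := K\<rparr>)" "M \<subseteq> N" "N \<noteq> K"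
    "\<And>x. x \<in> K - N \<Longrightarrow> generate (G\<lparr>carrier := K\<rparr>) (insert x N) = K"
    using K.G.exists_maximal_subgroup[of M] M K.finite_carrier by auto
  have NK: "N \<subseteq> K" using subgroup.subset[OF N(1)] by simp
  have "G.normal_in N K"
    using G.normal_in_restrict[OF K] K.maximal_subgroup_normal[OF N(1)] N(4) by simp
  moreover have "generate G (insert x N) = K" if "x \<in> K - N" for x
    using N(4)[OF that] G.generate_consistent[of "insert x N" K] that NK K by auto
  ultimately show thesis using that N by blast
qed

end

section \<open>Arc selections\<close>

text \<open>\<open>g s t^-1 g^-1\<close> is the quotient of the endpoints \<open>g s\<close> and
  \<open>g t\<close>. It lies in a subgroup \<open>K\<close> exactly when the two arcs out of
  \<open>g\<close> lead to the same right coset of \<open>K\<close>.\<close>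

definition (in group) arc_differences :: "('a \<Rightarrow> 'a set) \<Rightarrow> 'a set"
  where "arc_differences c =
    {g \<otimes> (s \<otimes> inv t) \<otimes> inv g | g s t. g \<in> carrier G \<and> s \<in> c g \<and> t \<in> c g}"

text \<open>\<open>c\<close> gives the admissible generators at each coset of \<open>K\<close>. As
  the differences lie in \<open>K\<close>, all admissible arcs from one coset lead to one coset. The
  condition at the identity keeps every \<open>s t^-1\<close> in \<open>K\<close>.\<close>

definition (in group) arc_selection :: "'a set \<Rightarrow> 'a set \<Rightarrow> ('a \<Rightarrow> 'a set) \<Rightarrow> bool"
  where "arc_selection S K c \<longleftrightarrow> subgroup K G \<and> left_invariant K c \<and>
    (\<forall>g\<in>carrier G. c g \<noteq> {} \<and> c g \<subseteq> S) \<and> c \<one> = S \<and> generate G (arc_differences c) = K"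

context group
begin

lemma arc_differencesI:
  "g \<in> carrier G \<Longrightarrow> s \<in> c g \<Longrightarrow> t \<in> c g \<Longrightarrow> g \<otimes> (s \<otimes> inv t) \<otimes> inv g \<in> arc_differences c"
  by (auto simp: arc_differences_def)

lemma arc_differencesE:
  assumes "x \<in> arc_differences c"
  obtains g s t where "g \<in> carrier G" "s \<in> c g" "t \<in> c g" "x = g \<otimes> (s \<otimes> inv t) \<otimes> inv g"
  using assms by (auto simp: arc_differences_def)

lemma arc_differences_mono:
  "(\<And>g. g \<in> carrier G \<Longrightarrow> c g \<subseteq> d g) \<Longrightarrow> arc_differences c \<subseteq> arc_differences d"
  by (fastforce simp: arc_differences_def)

lemma arc_differences_closed:
  "(\<And>g. g \<in> carrier G \<Longrightarrow> c g \<subseteq> carrier G) \<Longrightarrow> arc_differences c \<subseteq> carrier G"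
  by (fastforce simp: arc_differences_def)

lemma conj_conj:
  assumes "h \<in> carrier G" "g \<in> carrier G" "y \<in> carrier G"
  shows "h \<otimes> (g \<otimes> y \<otimes> inv g) \<otimes> inv h = (h \<otimes> g) \<otimes> y \<otimes> inv (h \<otimes> g)"
  using assms by (simp add: inv_mult_group m_assoc)

text \<open>Conjugation by \<open>h\<close> carries the difference of two arcs at \<open>g\<close>
  to that of the same generators at \<open>h g\<close>, where left invariance admits them as
  well.\<close>

lemma arc_differences_conj:
  assumes K: "subgroup K G" and inv: "left_invariant K c"
    and c: "\<And>g. g \<in> carrier G \<Longrightarrow> c g \<subseteq> carrier G"
    and h: "h \<in> K" and x: "x \<in> arc_differences c"
  shows "h \<otimes> x \<otimes> inv h \<in> arc_differences c"
proof -
  have hc: "h \<in> carrier G" using K h by (rule subgroup.mem_carrier)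
  obtain g s t where g: "g \<in> carrier G" "s \<in> c g" "t \<in> c g" "x = g \<otimes> (s \<otimes> inv t) \<otimes> inv g"
    using x by (rule arc_differencesE)
  have st: "s \<in> carrier G" "t \<in> carrier G" using c g by auto
  have "h \<otimes> x \<otimes> inv h = (h \<otimes> g) \<otimes> (s \<otimes> inv t) \<otimes> inv (h \<otimes> g)"
    unfolding g(4) by (rule conj_conj) (use hc g st in auto)
  then show ?thesis
    using arc_differencesI[of "h \<otimes> g" s c t] g hc left_invariantD[OF inv h g(1)] by simp
qed

lemma generate_arc_differences_normal:
  assumes K: "subgroup K G" and inv: "left_invariant K c"
    and c: "\<And>g. g \<in> carrier G \<Longrightarrow> c g \<subseteq> carrier G" and sub: "arc_differences c \<subseteq> K"
  shows "normal_in (generate G (arc_differences c)) K"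
  by (rule generate_normal_in[OF K sub]) (rule arc_differences_conj[OF K inv c])

end

text \<open>The cycle meets the coset \<open>K u\<close> only at step \<open>m\<close>. Using
  \<open>a\<close> instead of \<open>b\<close> there multiplies the next vertex by \<open>z\<close>
  on the left. The later generators depend only on the coset of \<open>K\<close>, so the factor
  \<open>z\<close> persists to the end.\<close>

lemma (in group) walk_switch_once:
  assumes fin: "finite (carrier G)"
    and cyc: "coset_cycle K r n" and m: "m < n" and u: "u = walk r m"
    and ab: "a \<in> carrier G" "b \<in> carrier G"
    and z: "z = u \<otimes> (a \<otimes> inv b) \<otimes> inv u" "z \<in> K"
    and ra: "ra = (\<lambda>g. if g \<otimes> inv u \<in> K then a else r g)"
    and rb: "rb = (\<lambda>g. if g \<otimes> inv u \<in> K then b else r g)"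
    and cycb: "coset_cycle K rb n"
  shows "walk ra n = z \<otimes> walk rb n"
proof -
  note D = coset_cycleD[OF cyc]
  note Db = coset_cycleD[OF cycb]
  have uc: "u \<in> carrier G" using D(7) u by simp
  have zc: "z \<in> carrier G" using D(1) z(2) by (rule subgroup.mem_carrier)
  have uK: "u \<otimes> inv u \<in> K" using D(1) uc by (simp add: subgroup.one_closed)
  have before: "walk rx j = walk r j" if "j \<le> m"
    and rx: "rx = (\<lambda>g. if g \<otimes> inv u \<in> K then x else r g)" for j x rx
    using that(1)
  proof (induction j)
    case (Suc j)
    have "walk r j \<otimes> inv u \<notin> K"
      using coset_cycle_distinct[OF fin cyc, of j m] Suc.prems m u by auto
    then show ?case using Suc by (simp add: walk_Suc rx)
  qed simp
  have wa: "walk ra m = u" and wb: "walk rb m = u" using before[OF _ ra] before[OF _ rb] u by auto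
  have "walk ra (Suc m + j) = z \<otimes> walk rb (Suc m + j)" if "Suc m + j \<le> n" for j
    using that
  proof (induction j)
    case 0
    have "walk ra (Suc m) = u \<otimes> a" "walk rb (Suc m) = u \<otimes> b"
      using wa wb uK by (simp_all add: walk_Suc ra rb)
    moreover have "z \<otimes> (u \<otimes> b) = u \<otimes> a \<otimes> (inv b \<otimes> (inv u \<otimes> u) \<otimes> b)"
      unfolding z(1) using uc ab by (simp only: m_assoc m_closed inv_closed)
    ultimately show ?case using uc ab by simp
  next
    case (Suc j)
    let ?g = "walk rb (Suc m + j)"
    have g: "?g \<in> carrier G" using Db(7) .
    have IH: "walk ra (Suc m + j) = z \<otimes> ?g" using Suc by simp
    have notin: "?g \<otimes> inv u \<notin> K"
    proof
      assume "?g \<otimes> inv u \<in> K"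
      then have "Suc m + j = m"
        by (intro coset_cycle_distinct[OF fin cycb]) (use Suc.prems wb m in auto)
      then show False by simp
    qed
    have "z \<otimes> ?g \<otimes> inv u \<notin> K"
    proof
      assume a: "z \<otimes> ?g \<otimes> inv u \<in> K"
      have "inv z \<otimes> (z \<otimes> ?g \<otimes> inv u) = ?g \<otimes> inv u"
        using zc g uc by (simp add: m_assoc[symmetric])
      moreover have "inv z \<otimes> (z \<otimes> ?g \<otimes> inv u) \<in> K"
        using a z(2) D(1) by (simp add: subgroup.m_closed subgroup.m_inv_closed)
      ultimately show False using notin by simp
    qed
    then have "ra (z \<otimes> ?g) = r (z \<otimes> ?g)" by (simp add: ra)
    then have "walk ra (Suc (Suc m + j)) = z \<otimes> ?g \<otimes> r (z \<otimes> ?g)"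
      using walk_Suc[of ra "Suc m + j"] unfolding IH by simp
    also have "r (z \<otimes> ?g) = r ?g" using left_invariantD[OF D(3) z(2) g] .
    also have "z \<otimes> ?g \<otimes> r ?g = z \<otimes> (?g \<otimes> rb ?g)"
      using notin zc g D(2)[OF g] by (simp add: rb m_assoc)
    finally show ?case unfolding walk_Suc[of rb "Suc m + j", symmetric] by simp
  qed
  from this[of "n - Suc m"] show ?thesis using m by simp
qed

context p_group_central_extension
begin

text \<open>A minimal selection \<open>d\<close> for \<open>K\<close> offers at least two generators
  at some coset \<open>K u\<close> other than \<open>K\<close>. Deleting a suitable \<open>i\<close>
  there shrinks the generated group to \<open>L\<close>, while a suitable \<open>j\<close> used
  there gives a cycle product that generates \<open>K\<close> over \<open>L\<close>; so the cycle
  lifts to the cosets of \<open>L\<close>.\<close>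

lemma arc_selection_step:
  assumes S: "S \<subseteq> carrier G" and sel: "G.arc_selection S K c" and cyc: "G.coset_cycle K r n"
    and rc: "\<And>g. g \<in> carrier G \<Longrightarrow> r g \<in> c g"
    and M: "M = generate G {s \<otimes> inv t | s t. s \<in> S \<and> t \<in> S}" and KM: "K \<noteq> M"
  shows "\<exists>L c' r' n'. G.arc_selection S L c' \<and> G.coset_cycle L r' n' \<and>
    (\<forall>g\<in>carrier G. r' g \<in> c' g) \<and> card L < card K"
proof -
  note fin = finite_carrier
  have K: "subgroup K G" and cinv: "G.left_invariant K c" and c1: "c \<one> = S"
    and cS: "\<And>g. g \<in> carrier G \<Longrightarrow> c g \<subseteq> S" and genc: "generate G (G.arc_differences c) = K"
    using sel by (auto simp: G.arc_selection_def)
  note Kc = subgroup.mem_carrier[OF K]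
  \<comment> \<open>Among the selections inside \<open>c\<close> whose differences still generate
    \<open>K\<close>, one with the fewest admissible arcs is taken.\<close>
  define good where "good d \<longleftrightarrow> G.left_invariant K d \<and>
    (\<forall>g\<in>carrier G. d g \<noteq> {} \<and> d g \<subseteq> c g) \<and> d \<one> = S" for d
  define \<mu> where "\<mu> d = (\<Sum>g\<in>carrier G. card (d g))" for d :: "'a \<Rightarrow> 'a set"
  have "good c" using sel cinv by (auto simp: good_def G.arc_selection_def)
  then have "\<exists>d. (good d \<and> generate G (G.arc_differences d) = K) \<and>
      (\<forall>d'. good d' \<and> generate G (G.arc_differences d') = K \<longrightarrow> \<mu> d \<le> \<mu> d')"
    using genc by (intro ex_has_least_nat[of _ c \<mu>]) auto
  then obtain d where good: "good d" and gend: "generate G (G.arc_differences d) = K"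
    and least: "\<And>d'. good d' \<Longrightarrow> generate G (G.arc_differences d') = K \<Longrightarrow> \<mu> d \<le> \<mu> d'"
    by blast
  have dinv: "G.left_invariant K d" and dc: "\<And>g. g \<in> carrier G \<Longrightarrow> d g \<subseteq> c g"
    and dne: "\<And>g. g \<in> carrier G \<Longrightarrow> d g \<noteq> {}" and d1: "d \<one> = S"
    using good by (auto simp: good_def)
  have dS: "d g \<subseteq> S" if "g \<in> carrier G" for g using dc[OF that] cS[OF that] by auto
  have dG: "d g \<subseteq> carrier G" if "g \<in> carrier G" for g using dS[OF that] S by auto
  have finS: "finite S" using S fin by (rule finite_subset)
  have Xd: "G.arc_differences d \<subseteq> K" unfolding gend[symmetric] by (auto intro: generate.incl)
  have Xc: "G.arc_differences c \<subseteq> K" unfolding genc[symmetric] by (auto intro: generate.incl)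

  have diffs: "{s \<otimes> inv t | s t. s \<in> S \<and> t \<in> S} \<subseteq> carrier G" using S by auto
  have Msub: "subgroup M G" unfolding M by (rule G.generate_is_subgroup[OF diffs])
  have MI: "s \<otimes> inv t \<in> M" if "s \<in> S" "t \<in> S" for s t
    unfolding M using that by (blast intro: generate.incl)
  have S_diff: "s \<otimes> inv t \<in> G.arc_differences f"
    if "s \<in> S" "t \<in> S" "f \<one> = S" for s t and f :: "'a \<Rightarrow> 'a set"
    using G.arc_differencesI[of \<one> s f t] that S by (simp add: subset_iff)
  have Mle: "M \<subseteq> N" if "subgroup N G" "\<And>s t. s \<in> S \<Longrightarrow> t \<in> S \<Longrightarrow> s \<otimes> inv t \<in> N" for N
    unfolding M by (rule G.generate_subgroup_incl) (use that in auto)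
  have MK: "M \<subseteq> K" by (rule Mle[OF K]) (use S_diff d1 Xd in blast)

  \<comment> \<open>With no choice outside \<open>K\<close>, every difference would be trivial or a
    \<open>K\<close>-conjugate of an element of \<open>M\<close>, hence in a proper normal subgroup
    of \<open>K\<close> containing \<open>M\<close>.\<close>
  have "\<exists>u\<in>carrier G. u \<notin> K \<and> (\<exists>s\<in>d u. \<exists>t\<in>d u. s \<noteq> t)"
  proof (rule ccontr)
    assume none: "\<not> ?thesis"
    obtain N where N: "G.normal_in N K" "M \<subseteq> N" "N \<noteq> K"
      by (rule exists_maximal_normal[OF K Msub MK]) (use KM in auto)
    have NG: "subgroup N G" using N by (simp add: G.normal_in_def)
    have "x \<in> N" if "x \<in> G.arc_differences d" for x
      using that
    proof (rule G.arc_differencesE)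
      fix g s t
      assume g: "g \<in> carrier G" "s \<in> d g" "t \<in> d g" "x = g \<otimes> (s \<otimes> inv t) \<otimes> inv g"
      show "x \<in> N"
      proof (cases "g \<in> K")
        case True
        then have "d g = S" using G.left_invariantD[OF dinv True, of \<one>] d1 g by simp
        then have "s \<otimes> inv t \<in> N" using MI N g by blast
        then show ?thesis using N(1) True g(4) by (simp add: G.normal_in_def)
      next
        case False
        then have "s = t" using none g by blast
        moreover have "s \<in> carrier G" using dG g by blast
        ultimately have "x = \<one>" using g by simp
        then show ?thesis using NG by (simp add: subgroup.one_closed)
      qed
    qed
    then have "K \<subseteq> N" unfolding gend[symmetric] by (intro G.generate_subgroup_incl NG) auto
    then show False using N by (auto simp: G.normal_in_def)
  qed
  then obtain u0 a0 b0 where u0: "u0 \<in> carrier G" "u0 \<notin> K" "a0 \<in> d u0" "b0 \<in> d u0" "a0 \<noteq> b0"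
    by blast

  \<comment> \<open>The choice depends only on the set \<open>d g\<close>, so \<open>r0\<close>
    inherits left invariance from \<open>d\<close>.\<close>
  define r0 where "r0 g = (SOME s. s \<in> d g)" for g
  have r0: "r0 g \<in> d g" if "g \<in> carrier G" for g
    unfolding r0_def using dne[OF that] by (simp add: some_in_eq)
  have r0inv: "G.left_invariant K r0"
    using dinv by (simp add: G.left_invariant_def r0_def)
  \<comment> \<open>The differences of \<open>c\<close> lie in \<open>K\<close>, so any left
    invariant choice from \<open>d\<close> visits the same cosets as \<open>r\<close>.\<close>
  have switch: "G.coset_cycle K r' n"
    if "G.left_invariant K r'" "\<And>g. g \<in> carrier G \<Longrightarrow> r' g \<in> d g" for r'
  proof (rule G.coset_cycle_switch[OF cyc _ that(1)])
    fix g assume g: "g \<in> carrier G"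
    show r'c: "r' g \<in> carrier G" using that(2) dG g by blast
    have "g \<otimes> (r' g \<otimes> inv (r g)) \<otimes> inv g \<in> K"
      using G.arc_differencesI[of g "r' g" c "r g"] that(2)[OF g] rc[OF g] dc[OF g] Xc g by blast
    then show "g \<otimes> r' g \<otimes> inv (r g) \<otimes> inv g \<in> K"
      using g r'c G.coset_cycleD(2)[OF cyc g] by (simp add: G.m_assoc)
  qed
  have cyc0: "G.coset_cycle K r0 n" using switch[OF r0inv r0] .
  note D0 = G.coset_cycleD[OF cyc0]

  \<comment> \<open>\<open>u0\<close> is replaced by the vertex \<open>u\<close> of the walk in the
    same coset, since the exchange of generators is computed along the walk.\<close>
  obtain h0 m where m: "h0 \<in> K" "m < n" "u0 = h0 \<otimes> G.walk r0 m" using D0(6)[OF u0(1)] by blast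
  define u where "u = G.walk r0 m"
  have uc: "u \<in> carrier G" using D0(7) by (simp add: u_def)
  have uK: "u \<notin> K" using m u0(2) K by (auto simp: u_def subgroup.m_closed)
  define J where "J = d u"
  have J: "a0 \<in> J" "b0 \<in> J"
    using u0 m G.left_invariantD[OF dinv m(1) uc] by (auto simp: J_def u_def)
  have JG: "J \<subseteq> carrier G" using dG uc by (simp add: J_def)
  have finJ: "finite J" using dS[OF uc] finS by (auto simp: J_def intro: finite_subset)
  define B where "B g \<longleftrightarrow> g \<otimes> inv u \<in> K" for g
  have Binv: "B (h \<otimes> g) \<longleftrightarrow> B g" if h: "h \<in> K" and g: "g \<in> carrier G" for h g
  proof
    assume "B (h \<otimes> g)"
    then have "inv h \<otimes> (h \<otimes> g \<otimes> inv u) \<in> K"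
      using h K by (simp add: B_def subgroup.m_closed subgroup.m_inv_closed)
    moreover have "inv h \<otimes> (h \<otimes> g \<otimes> inv u) = g \<otimes> inv u"
      using g uc Kc[OF h] by (simp add: G.m_assoc[symmetric])
    ultimately show "B g" by (simp add: B_def)
  next
    assume "B g"
    then show "B (h \<otimes> g)"
      using h K g uc Kc[OF h] by (simp add: B_def G.m_assoc subgroup.m_closed)
  qed
  have B1: "\<not> B \<one>"
  proof
    assume "B \<one>"
    then have "inv u \<in> K" using uc by (simp add: B_def)
    then have "inv (inv u) \<in> K" by (rule subgroup.m_inv_closed[OF K])
    then show False using uc uK by simp
  qed
  have BJ: "d g = J" if "g \<in> carrier G" "B g" for g
  proof -
    have "d ((g \<otimes> inv u) \<otimes> u) = d u"
      using that uc by (intro G.left_invariantD[OF dinv]) (auto simp: B_def)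
    then show ?thesis using that uc by (simp add: J_def G.m_assoc)
  qed

  \<comment> \<open>At the coset \<open>K u\<close>, marked by \<open>B\<close>, \<open>cc i\<close>
    forbids \<open>i\<close> whereas \<open>rr i\<close> uses it; \<open>\<rho> i\<close> is the
    product around the resulting cycle.\<close>
  define cc where "cc i g = (if B g then d g - {i} else d g)" for i g
  define rr where "rr i g = (if B g then i else r0 g)" for i g
  define \<rho> where "\<rho> i = G.walk (rr i) n" for i
  define z where "z s t = u \<otimes> (s \<otimes> inv t) \<otimes> inv u" for s t
  have ccinv: "G.left_invariant K (cc i)" for i
    using dinv Binv by (simp add: G.left_invariant_def cc_def)
  have ccd: "cc i g \<subseteq> d g" for i g by (auto simp: cc_def)
  have ccG: "cc i g \<subseteq> carrier G" if "g \<in> carrier G" for i g using ccd dG[OF that] by blast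
  have cc1: "cc i \<one> = S" for i using B1 d1 by (simp add: cc_def)
  have Xcc: "G.arc_differences (cc i) \<subseteq> K" for i
    using G.arc_differences_mono[of "cc i" d] ccd Xd by blast
  have cyci: "G.coset_cycle K (rr i) n" if "i \<in> J" for i
  proof (rule switch)
    show "G.left_invariant K (rr i)"
      using r0inv Binv by (simp add: G.left_invariant_def rr_def)
    show "rr i g \<in> d g" if "g \<in> carrier G" for g
      using r0[OF that] BJ[OF that] \<open>i \<in> J\<close> by (auto simp: rr_def)
  qed
  have zK: "z s t \<in> K" if "s \<in> J" "t \<in> J" for s t
    using G.arc_differencesI[of u s d t] that uc Xd by (auto simp: z_def J_def)
  have \<rho>K: "\<rho> i \<in> K" if "i \<in> J" for i
    using G.coset_cycleD(4)[OF cyci[OF that]] by (simp add: \<rho>_def)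
  have \<rho>: "\<rho> s = z s t \<otimes> \<rho> t" if st: "s \<in> J" "t \<in> J" for s t
    unfolding \<rho>_def
    by (rule G.walk_switch_once[OF fin cyc0 m(2) u_def _ _ z_def zK[OF st] _ _ cyci[OF st(2)]])
      (use st JG in \<open>auto simp: rr_def B_def\<close>)
  have z\<rho>: "z s t = \<rho> s \<otimes> inv (\<rho> t)" if "s \<in> J" "t \<in> J" for s t
    using \<rho>[OF that] Kc[OF \<rho>K[OF that(2)]] Kc[OF zK[OF that]] by (simp add: G.m_assoc)

  \<comment> \<open>Differences of \<open>d\<close> at the coset \<open>K u\<close> are
    \<open>K\<close>-conjugates of the \<open>z s t\<close>; all others belong to every
    \<open>cc i\<close>. A normal subgroup of \<open>K\<close> containing both kinds is all of
    \<open>K\<close>.\<close>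
  have generates: "K \<subseteq> R"
    if R: "G.normal_in R K" and zR: "\<And>s t. s \<in> J \<Longrightarrow> t \<in> J \<Longrightarrow> z s t \<in> R"
      and R': "(\<Inter>i\<in>J. G.arc_differences (cc i)) \<subseteq> R" for R
  proof -
    have "x \<in> R" if "x \<in> G.arc_differences d" for x
      using that
    proof (rule G.arc_differencesE)
      fix g s t
      assume g: "g \<in> carrier G" "s \<in> d g" "t \<in> d g" "x = g \<otimes> (s \<otimes> inv t) \<otimes> inv g"
      have st: "s \<in> carrier G" "t \<in> carrier G" using g dG by auto
      show "x \<in> R"
      proof (cases "B g")
        case True
        have h: "g \<otimes> inv u \<in> K" using True by (simp add: B_def)
        have "(g \<otimes> inv u) \<otimes> z s t \<otimes> inv (g \<otimes> inv u) =
            ((g \<otimes> inv u) \<otimes> u) \<otimes> (s \<otimes> inv t) \<otimes> inv ((g \<otimes> inv u) \<otimes> u)"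
          unfolding z_def by (rule G.conj_conj) (use g uc st in auto)
        also have "\<dots> = x" using g uc by (simp add: G.m_assoc)
        finally have "x = (g \<otimes> inv u) \<otimes> z s t \<otimes> inv (g \<otimes> inv u)" by (rule sym)
        moreover have "z s t \<in> R" using zR g BJ[OF g(1) True] by blast
        ultimately show ?thesis using R h by (simp add: G.normal_in_def)
      next
        case False
        then have "x \<in> G.arc_differences (cc i)" for i
          using G.arc_differencesI[of g s "cc i" t] g by (simp add: cc_def)
        then show ?thesis using R' by blast
      qed
    qed
    then show ?thesis
      unfolding gend[symmetric] using R by (intro G.generate_subgroup_incl) (auto simp: G.normal_in_def)
  qed

  \<comment> \<open>Otherwise each \<open>i\<close> has a maximal normal subgroup \<open>N i\<close>
    of \<open>K\<close> that contains \<open>\<rho> j\<close> for all other \<open>j\<close> but not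
    \<open>\<rho> i\<close>. The sum of the associated homomorphisms yields a proper normal subgroup
    \<open>R\<close> of \<open>K\<close> that contains all \<open>z s t\<close> and the differences
    common to all \<open>cc i\<close>, contrary to \<open>generates\<close>.\<close>
  have "\<exists>i\<in>J. \<exists>j\<in>J. i \<noteq> j \<and> generate G (insert (\<rho> j) (generate G (G.arc_differences (cc i)))) = K"
  proof (rule ccontr)
    assume none: "\<not> ?thesis"
    have ex: "\<exists>N. G.normal_in N K \<and> N \<noteq> K \<and> G.arc_differences (cc i) \<subseteq> N \<and>
        (\<forall>j\<in>J. j \<noteq> i \<longrightarrow> \<rho> j \<in> N) \<and> (\<forall>x\<in>K - N. generate G (insert x N) = K)" if i: "i \<in> J" for i
    proof -
      obtain j where j: "j \<in> J" "j \<noteq> i" using J u0(5) by metis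
      let ?A = "insert (\<rho> j) (generate G (G.arc_differences (cc i)))"
      have A: "?A \<subseteq> K" using \<rho>K[OF j(1)] G.generate_subgroup_incl[OF Xcc K] by auto
      have AG: "?A \<subseteq> carrier G" using A Kc by blast
      have "subgroup (generate G ?A) G" by (rule G.generate_is_subgroup[OF AG])
      moreover have "generate G ?A \<subseteq> K" by (rule G.generate_subgroup_incl[OF A K])
      moreover have "generate G ?A \<noteq> K"
      proof
        assume eq: "generate G ?A = K"
        show False
          by (rule none[THEN notE], rule bexI[OF _ i], rule bexI[OF _ j(1)]) (use eq j(2) in simp)
      qed
      ultimately obtain N where N: "G.normal_in N K" "generate G ?A \<subseteq> N" "N \<noteq> K"
        "\<And>x. x \<in> K - N \<Longrightarrow> generate G (insert x N) = K"
        by (rule exists_maximal_normal[OF K]) blast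
      have A': "?A \<subseteq> N" using N(2) by (auto intro: generate.incl)
      then have X: "G.arc_differences (cc i) \<subseteq> N" by (auto intro: generate.incl)
      have NG: "subgroup N G" using N(1) by (simp add: G.normal_in_def)
      \<comment> \<open>One \<open>\<rho> j\<close> inside \<open>N\<close> suffices:
        \<open>l\<close> and \<open>j\<close> both remain admissible in \<open>cc i\<close>, so
        \<open>z l j\<close> lies in \<open>N\<close> too.\<close>
      have "\<rho> l \<in> N" if l: "l \<in> J" "l \<noteq> i" for l
      proof -
        have "u \<otimes> (l \<otimes> inv j) \<otimes> inv u \<in> G.arc_differences (cc i)"
          by (rule G.arc_differencesI) (use l j uc in \<open>auto simp: cc_def J_def\<close>)
        then have "z l j \<in> N" using X by (auto simp: z_def)
        then show ?thesis using \<rho>[OF l(1) j(1)] A' NG by (simp add: subgroup.m_closed)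
      qed
      then show ?thesis using N X by blast
    qed
    from bchoice[OF ballI[OF ex]] obtain N where NJ: "\<forall>i\<in>J. G.normal_in (N i) K \<and> N i \<noteq> K \<and>
        G.arc_differences (cc i) \<subseteq> N i \<and> (\<forall>j\<in>J. j \<noteq> i \<longrightarrow> \<rho> j \<in> N i) \<and>
        (\<forall>x\<in>K - N i. generate G (insert x (N i)) = K)"
      by (rule exE)
    have N: "G.normal_in (N i) K" "N i \<noteq> K" "G.arc_differences (cc i) \<subseteq> N i"
      "\<And>j. j \<in> J \<Longrightarrow> j \<noteq> i \<Longrightarrow> \<rho> j \<in> N i"
      "\<And>x. x \<in> K - N i \<Longrightarrow> generate G (insert x (N i)) = K" if "i \<in> J" for i
      using NJ[rule_format, OF that] by simp_all
    have NG: "subgroup (N i) G" "N i \<subseteq> K" if "i \<in> J" for i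
      using N(1)[OF that] by (auto simp: G.normal_in_def)
    \<comment> \<open>With all \<open>\<rho> j\<close> in \<open>N i\<close>, their quotients
      \<open>z s t\<close> would lie there as well, and \<open>generates\<close> would give
      \<open>N i = K\<close>.\<close>
    have notin: "\<rho> i \<notin> N i" if i: "i \<in> J" for i
    proof
      assume "\<rho> i \<in> N i"
      then have all: "\<rho> j \<in> N i" if "j \<in> J" for j using N(4)[OF i that] by blast
      have "K \<subseteq> N i"
      proof (rule generates[OF N(1)[OF i]])
        show "z s t \<in> N i" if "s \<in> J" "t \<in> J" for s t
          using z\<rho>[OF that] all that NG(1)[OF i] by (simp add: subgroup.m_closed subgroup.m_inv_closed)
      qed (use N(3)[OF i] i in blast)
      then show False using NG(2)[OF i] N(2)[OF i] by blast
    qed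
    \<comment> \<open>\<open>i\<close> and \<open>j\<close> both remain admissible at the identity,
      so \<open>i j^-1\<close> lies in \<open>N i\<close>. Its \<open>p^k\<close>-th power is
      central and hence shared by the conjugate \<open>z i j\<close>; and \<open>\<rho> i\<close> is
      \<open>z i j\<close> times an element of \<open>N i\<close>.\<close>
    have pow: "\<rho> i [^] (p ^ k) \<in> N i" if i: "i \<in> J" for i
    proof -
      obtain j where j: "j \<in> J" "j \<noteq> i" using J u0(5) by metis
      have ij: "i \<in> carrier G" "j \<in> carrier G" "i \<in> S" "j \<in> S"
        using i j JG dS[OF uc] by (auto simp: J_def)
      have "i \<otimes> inv j \<in> N i" using S_diff[OF ij(3,4)] cc1[of i] N(3)[OF i] by blast
      then have "(i \<otimes> inv j) [^] q \<in> N i" for q :: nat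
        using NG(1)[OF i] by (induction q) (auto simp: subgroup.m_closed subgroup.one_closed)
      then have "z i j [^] (p ^ k) \<in> N i"
        using conj_pow_order[OF uc, of "i \<otimes> inv j"] ij by (simp add: z_def)
      then show ?thesis
        using G.normal_in_pow_mult[OF N(1)[OF i] zK[OF i j(1)] N(4)[OF i j]] \<rho>[OF i j(1)] by simp
    qed
    interpret GK: group "G\<lparr>carrier := K\<rparr>" using K by (rule G.subgroup_imp_group)
    have finK: "finite (carrier (G\<lparr>carrier := K\<rparr>))"
      using finite_subset[OF subgroup.subset[OF K] fin] by simp
    obtain R where R: "GK.normal_in R K" "R \<noteq> K" "(\<Inter>i\<in>J. N i) \<subseteq> R"
      "\<And>i j. i \<in> J \<Longrightarrow> j \<in> J \<Longrightarrow> \<rho> i \<otimes> inv\<^bsub>G\<lparr>carrier := K\<rparr>\<^esub> \<rho> j \<in> R"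
    proof (rule GK.exists_common_normal_subgroup[OF finK prime_p finJ, of N \<rho> k])
      show "generate (G\<lparr>carrier := K\<rparr>) (insert (\<rho> i) (N i)) = carrier (G\<lparr>carrier := K\<rparr>)"
        if "i \<in> J" for i
        using N(5)[OF that, of "\<rho> i"] notin[OF that] \<rho>K[OF that] NG[OF that] K
          G.generate_consistent[of "insert (\<rho> i) (N i)" K] by simp
    qed (use J N(1,4) \<rho>K notin pow G.normal_in_restrictI in \<open>auto simp: G.pow_restrict\<close>)
    have RK: "G.normal_in R K" using G.normal_in_restrict[OF K R(1)] .
    have "K \<subseteq> R"
    proof (rule generates[OF RK])
      show "z s t \<in> R" if "s \<in> J" "t \<in> J" for s t
        using R(4)[OF that] z\<rho>[OF that] G.m_inv_consistent[OF K \<rho>K[OF that(2)]] by simp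
      show "(\<Inter>i\<in>J. G.arc_differences (cc i)) \<subseteq> R" using N(3) R(3) by blast
    qed
    then show False using RK R(2) by (auto simp: G.normal_in_def)
  qed
  then obtain i j where ij: "i \<in> J" "j \<in> J" "i \<noteq> j"
    and gen: "generate G (insert (\<rho> j) (generate G (G.arc_differences (cc i)))) = K" by blast
  define L where "L = generate G (G.arc_differences (cc i))"
  have LK: "G.normal_in L K"
    unfolding L_def by (rule G.generate_arc_differences_normal[OF K ccinv ccG Xcc])
  have Lsub: "subgroup L G" "L \<subseteq> K" using LK by (auto simp: G.normal_in_def)
  have ccne: "cc i g \<noteq> {}" if "g \<in> carrier G" for g
    using dne[OF that] BJ[OF that] ij by (auto simp: cc_def)
  \<comment> \<open>If \<open>L\<close> were \<open>K\<close>, then \<open>cc i\<close> would be a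
    selection for \<open>K\<close> with fewer arcs than \<open>d\<close>.\<close>
  have "L \<noteq> K"
  proof
    assume "L = K"
    moreover have "good (cc i)"
      using ccinv cc1 ccne ccd dc by (fastforce simp: good_def)
    ultimately have "\<mu> d \<le> \<mu> (cc i)" using least L_def by blast
    moreover have "\<mu> (cc i) < \<mu> d"
      unfolding \<mu>_def
    proof (rule sum_strict_mono_ex1[OF fin])
      have fd: "finite (d g)" if "g \<in> carrier G" for g
        using dS[OF that] finS by (rule finite_subset)
      show "\<forall>g\<in>carrier G. card (cc i g) \<le> card (d g)"
        by (intro ballI card_mono fd ccd)
      have "B u" using uc K by (simp add: B_def subgroup.one_closed)
      then have "cc i u \<subset> d u" using ij by (auto simp: cc_def J_def)
      then show "\<exists>g\<in>carrier G. card (cc i g) < card (d g)"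
        using fd[OF uc] uc by (blast intro: psubset_card_mono)
    qed
    ultimately show False by simp
  qed
  then have card: "card L < card K"
    using Lsub K fin by (metis finite_subset psubsetI psubset_card_mono subgroup.subset)
  have ccS: "cc i g \<subseteq> S" if "g \<in> carrier G" for g using ccd dS[OF that] by blast
  obtain n' where "G.coset_cycle L (rr j) n'"
    using G.coset_cycle_refine[OF fin cyci[OF ij(2)] LK] gen by (auto simp: L_def \<rho>_def)
  moreover have "G.arc_selection S L (cc i)"
    unfolding G.arc_selection_def
    using Lsub(1) G.left_invariant_mono[OF ccinv Lsub(2)] ccne ccS cc1 by (simp add: L_def)
  \<comment> \<open>\<open>j\<close> survives the deletion of \<open>i\<close>, so the cycle that
    uses \<open>j\<close> at \<open>K u\<close> respects the smaller selection.\<close>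
  moreover have "rr j g \<in> cc i g" if "g \<in> carrier G" for g
    using r0[OF that] BJ[OF that] ij by (auto simp: rr_def cc_def)
  ultimately show ?thesis using card by blast
qed

end

section \<open>The induction\<close>

context p_group_central_extension
begin

text \<open>Each step lowers \<open>card K\<close> as long as \<open>K\<close> differs from
  \<open>M\<close>, so the descent can only end at \<open>M\<close>.\<close>

lemma arc_selection_descend:
  assumes S: "S \<subseteq> carrier G" and M: "M = generate G {s \<otimes> inv t | s t. s \<in> S \<and> t \<in> S}"
    and "G.arc_selection S K c" and "G.coset_cycle K r n" and "\<And>g. g \<in> carrier G \<Longrightarrow> r g \<in> c g"
  shows "\<exists>r n. G.coset_cycle M r n \<and> (\<forall>g\<in>carrier G. r g \<in> S)"
  using assms(3-)
proof (induction "card K" arbitrary: K c r n rule: less_induct)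
  case less
  show ?case
  proof (cases "K = M")
    case True
    have "r g \<in> S" if "g \<in> carrier G" for g
      using less.prems(1) less.prems(3)[OF that] that unfolding G.arc_selection_def by blast
    then show ?thesis using less.prems(2) True by blast
  next
    case False
    obtain L c' r' n' where L: "G.arc_selection S L c'" "G.coset_cycle L r' n'"
      "\<And>g. g \<in> carrier G \<Longrightarrow> r' g \<in> c' g" "card L < card K"
      using arc_selection_step[OF S less.prems M False] by metis
    show ?thesis using less.hyps[OF L(4) L(1-3)] .
  qed
qed

text \<open>The descent starts from the full selection, with \<open>S\<close> admissible everywhere.
  Its \<open>K\<close> is normal in \<open>G\<close> with cyclic quotient, because all generators
  agree modulo \<open>K\<close>; repeating one generator \<open>s\<close> is a hamiltonian cycle of
  the cosets.\<close>

lemma exists_coset_cycle: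
  assumes S: "S \<subseteq> carrier G" "S \<noteq> {}" and gen: "generate G S = carrier G"
    and M: "M = generate G {s \<otimes> inv t | s t. s \<in> S \<and> t \<in> S}"
  shows "\<exists>r n. G.coset_cycle M r n \<and> (\<forall>g\<in>carrier G. r g \<in> S)"
proof -
  obtain s where s: "s \<in> S" using S(2) by blast
  define c where "c = (\<lambda>g::'a. S)"
  define K where "K = generate G (G.arc_differences c)"
  have cinv: "G.left_invariant H c" for H by (simp add: G.left_invariant_def c_def)
  have X: "G.arc_differences c \<subseteq> carrier G"
    by (rule G.arc_differences_closed) (use S in \<open>simp add: c_def\<close>)
  have nor: "G.normal_in K (carrier G)"
    unfolding K_def
    by (rule G.generate_arc_differences_normal[OF G.subgroup_self cinv _ X]) (use S in \<open>simp add: c_def\<close>)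
  then have Ksub: "subgroup K G" by (simp add: G.normal_in_def)
  \<comment> \<open>A loop at the only coset of \<open>carrier G\<close> is a cycle of length 1;
    lifting it gives the cycle for \<open>K\<close>.\<close>
  have cyc1: "G.coset_cycle (carrier G) (\<lambda>_. s) 1"
    using s S(1) G.subgroup_self
    by (auto simp: G.coset_cycle_def G.left_invariant_def G.walk_def order_def)
  have genK: "generate G (insert (G.walk (\<lambda>_. s) 1) K) = carrier G"
  proof
    have w: "G.walk (\<lambda>_. s) 1 = s" using s S(1) by (auto simp: G.walk_def)
    have sub: "insert s K \<subseteq> carrier G" using s S(1) subgroup.subset[OF Ksub] by auto
    have sg: "subgroup (generate G (insert s K)) G" by (rule G.generate_is_subgroup[OF sub])
    then show "generate G (insert (G.walk (\<lambda>_. s) 1) K) \<subseteq> carrier G"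
      unfolding w by (rule subgroup.subset)
    have "t \<in> generate G (insert s K)" if t: "t \<in> S" for t
    proof -
      have tc: "t \<in> carrier G" "s \<in> carrier G" using t s S(1) by auto
      have "t \<otimes> inv s \<in> G.arc_differences c"
        using G.arc_differencesI[of \<one> t c s] t s tc by (simp add: c_def)
      then have "t \<otimes> inv s \<in> K" unfolding K_def by (rule generate.incl)
      then have "t \<otimes> inv s \<in> generate G (insert s K)" by (simp add: generate.incl)
      then have "(t \<otimes> inv s) \<otimes> s \<in> generate G (insert s K)"
        by (rule generate.eng) (simp add: generate.incl)
      then show ?thesis using tc by (simp add: G.m_assoc)
    qed
    then have "generate G S \<subseteq> generate G (insert s K)"
      by (intro G.generate_subgroup_incl[OF _ sg]) auto
    then show "carrier G \<subseteq> generate G (insert (G.walk (\<lambda>_. s) 1) K)" unfolding w gen .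
  qed
  obtain n where n: "G.coset_cycle K (\<lambda>_. s) n"
    using G.coset_cycle_refine[OF finite_carrier cyc1 nor genK] by blast
  have "G.arc_selection S K c"
    using Ksub cinv S(2) by (simp add: G.arc_selection_def c_def K_def)
  then show ?thesis
    using arc_selection_descend[OF S(1) M _ n] s by (simp add: c_def)
qed

text \<open>Minimality puts \<open>T - {t}\<close> and the kernel into a maximal normal subgroup
  \<open>N t\<close> that omits \<open>t\<close>. The kernel contains all \<open>p^k\<close>-th
  powers, so the quotient by \<open>N t\<close> is a \<open>p\<close>-group; the sum of the
  resulting homomorphisms to Z/p kills every \<open>s t^-1\<close>.\<close>

lemma generate_differences_proper:
  assumes T: "T \<subseteq> carrier G" "T \<noteq> {}" and gen: "generate G T = carrier G"
    and min: "\<And>t. t \<in> T \<Longrightarrow> generate G ((T - {t}) \<union> kernel G P \<pi>) \<noteq> carrier G"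
  shows "generate G {s \<otimes> inv t | s t. s \<in> T \<and> t \<in> T} \<noteq> carrier G"
proof -
  have ker: "kernel G P \<pi> \<subseteq> carrier G" by (auto simp: kernel_def)
  have finT: "finite T" using T(1) finite_carrier by (rule finite_subset)
  have ex: "\<exists>N. G.normal_in N (carrier G) \<and> N \<noteq> carrier G \<and> (T - {t}) \<union> kernel G P \<pi> \<subseteq> N \<and>
      (\<forall>x\<in>carrier G - N. generate G (insert x N) = carrier G)" if t: "t \<in> T" for t
  proof -
    let ?A = "(T - {t}) \<union> kernel G P \<pi>"
    have A: "?A \<subseteq> carrier G" using T ker by auto
    have sg: "subgroup (generate G ?A) G" by (rule G.generate_is_subgroup[OF A])
    obtain N where "G.normal_in N (carrier G)" "generate G ?A \<subseteq> N" "N \<noteq> carrier G"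
      "\<And>x. x \<in> carrier G - N \<Longrightarrow> generate G (insert x N) = carrier G"
      by (rule exists_maximal_normal[OF G.subgroup_self sg subgroup.subset[OF sg] min[OF t]]) blast
    moreover have "?A \<subseteq> generate G ?A" by (auto intro: generate.incl)
    ultimately show ?thesis by (intro exI[of _ N]) auto
  qed
  from bchoice[OF ballI[OF ex]] obtain N where NT: "\<forall>t\<in>T. G.normal_in (N t) (carrier G) \<and>
      N t \<noteq> carrier G \<and> (T - {t}) \<union> kernel G P \<pi> \<subseteq> N t \<and>
      (\<forall>x\<in>carrier G - N t. generate G (insert x (N t)) = carrier G)"
    by (rule exE)
  have N: "G.normal_in (N t) (carrier G)" "N t \<noteq> carrier G" "(T - {t}) \<union> kernel G P \<pi> \<subseteq> N t"
    "\<And>x. x \<in> carrier G - N t \<Longrightarrow> generate G (insert x (N t)) = carrier G" if "t \<in> T" for t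
    using NT[rule_format, OF that] by simp_all
  have Nsub: "subgroup (N t) G" if "t \<in> T" for t
    using N(1)[OF that] by (simp add: G.normal_in_def)
  have notin: "t \<notin> N t" if t: "t \<in> T" for t
  proof
    assume "t \<in> N t"
    then have "T \<subseteq> N t" using N(3)[OF t] by auto
    then have "carrier G \<subseteq> N t" unfolding gen[symmetric] by (rule G.generate_subgroup_incl[OF _ Nsub[OF t]])
    then show False using N(2)[OF t] subgroup.subset[OF Nsub[OF t]] by blast
  qed
  obtain R where R: "G.normal_in R (carrier G)" "R \<noteq> carrier G"
    "\<And>s t. s \<in> T \<Longrightarrow> t \<in> T \<Longrightarrow> s \<otimes> inv t \<in> R"
  proof (rule G.exists_common_normal_subgroup[OF finite_carrier prime_p finT T(2), of N "\<lambda>t. t" k])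
    show "t \<in> carrier G" if "t \<in> T" for t using that T by auto
    show "generate G (insert t (N t)) = carrier G" if "t \<in> T" for t
      using N(4)[OF that] notin[OF that] that T by auto
    show "s \<in> N t" if "s \<in> T" "t \<in> T" "s \<noteq> t" for s t using N(3)[OF that(2)] that by auto
    show "t [^] (p ^ k) \<in> N t" if "t \<in> T" for t
      using pow_order_in_kernel[of t] N(3)[OF that] that T by auto
  qed (use N(1) notin in auto)
  have Rsub: "subgroup R G" using R(1) by (simp add: G.normal_in_def)
  have "generate G {s \<otimes> inv t | s t. s \<in> T \<and> t \<in> T} \<subseteq> R"
    by (rule G.generate_subgroup_incl[OF _ Rsub]) (use R(3) in auto)
  then show ?thesis using R(2) subgroup.subset[OF Rsub] by blast
qed

text \<open>Let \<open>s w\<close> be a hamiltonian cycle of the cosets of the proper subgroup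
  \<open>M\<close>. Following \<open>w\<close> after any \<open>t\<close> in \<open>T\<close>
  returns to \<open>M\<close>, so the elements \<open>t x\<close>, with \<open>x\<close> the product
  of \<open>w\<close>, are handed to the induction hypothesis for \<open>M\<close>.\<close>

lemma ham_word_of_minimal:
  assumes T: "T \<subseteq> carrier G" "T \<noteq> {}" and gen: "generate G T = carrier G"
    and min: "\<And>t. t \<in> T \<Longrightarrow> generate G ((T - {t}) \<union> kernel G P \<pi>) \<noteq> carrier G"
    and IH: "\<And>M S. subgroup M G \<Longrightarrow> M \<noteq> carrier G \<Longrightarrow> S \<subseteq> M \<Longrightarrow> generate G S = M \<Longrightarrow>
      \<exists>v. G.ham_word M S v"
  shows "\<exists>w. G.ham_word (carrier G) T w"
proof -
  define X where "X = {s \<otimes> inv t | s t. s \<in> T \<and> t \<in> T}"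
  define M where "M = generate G X"
  have XG: "X \<subseteq> carrier G" using T by (auto simp: X_def)
  have M: "subgroup M G" unfolding M_def by (rule G.generate_is_subgroup[OF XG])
  have MG: "M \<noteq> carrier G"
    using generate_differences_proper[OF T gen min] by (simp add: M_def X_def)
  obtain r n where cyc: "G.coset_cycle M r n" and rT: "\<And>g. g \<in> carrier G \<Longrightarrow> r g \<in> T"
    using exists_coset_cycle[OF T gen, of M] by (auto simp: M_def X_def)
  note D = G.coset_cycleD[OF cyc]
  have "n > 0" using D(5) finite_carrier G.order_gt_0_iff_finite by (cases n) auto
  define w' where "w' = map (\<lambda>j. r (G.walk r j)) [0..<n]"
  have w'T: "set w' \<subseteq> T" using rT D(7) by (auto simp: w'_def)
  have take: "G.list_mult (take j w') = G.walk r j" if "j \<le> n" for j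
    using G.list_mult_walk[of r j] D(2) that by (simp add: w'_def take_map)
  have len: "length w' = n" by (simp add: w'_def)
  then obtain s w where w: "w' = s # w" using \<open>n > 0\<close> by (cases w') auto
  have sT: "s \<in> T" "set w \<subseteq> T" using w'T by (auto simp: w)
  have sG: "s \<in> carrier G" "set w \<subseteq> carrier G" using sT T by auto
  define x where "x = G.list_mult w"
  have xG: "x \<in> carrier G" using sG by (simp add: x_def)
  have prod: "s \<otimes> x \<in> M" using take[of n] len w D(4) by (simp add: x_def)
  have XM: "t \<otimes> inv t' \<in> M" if "t \<in> T" "t' \<in> T" for t t'
    unfolding M_def X_def using that by (blast intro: generate.incl)
  let ?S = "(\<lambda>t. t \<otimes> x) ` T"
  have SM: "?S \<subseteq> M"
  proof (rule image_subsetI)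
    fix t assume t: "t \<in> T"
    then have "t \<in> carrier G" using T by auto
    then have "t \<otimes> x = (t \<otimes> inv s) \<otimes> (s \<otimes> x)"
      using sG xG by (simp add: G.m_assoc) (simp add: G.m_assoc[symmetric])
    then show "t \<otimes> x \<in> M" using XM[OF t sT(1)] prod M by (simp add: subgroup.m_closed)
  qed
  \<comment> \<open>The quotient of two of these elements is \<open>a b^-1\<close>, so they generate
    every difference and hence \<open>M\<close>.\<close>
  have "generate G ?S = M"
  proof
    show "generate G ?S \<subseteq> M" by (rule G.generate_subgroup_incl[OF SM M])
    have sg: "subgroup (generate G ?S) G"
      by (rule G.generate_is_subgroup) (use SM subgroup.subset[OF M] in auto)
    have "X \<subseteq> generate G ?S"
    proof
      fix y assume "y \<in> X"
      then obtain a b where y: "y = a \<otimes> inv b" "a \<in> T" "b \<in> T" by (auto simp: X_def)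
      have ab: "a \<in> carrier G" "b \<in> carrier G" using y T by auto
      have "(a \<otimes> x) \<otimes> inv (b \<otimes> x) = a \<otimes> (x \<otimes> inv x) \<otimes> inv b"
        using ab xG by (simp only: G.inv_mult_group G.m_assoc G.m_closed G.inv_closed)
      then have "y = (a \<otimes> x) \<otimes> inv (b \<otimes> x)" using ab xG y by simp
      moreover have "a \<otimes> x \<in> generate G ?S" "inv (b \<otimes> x) \<in> generate G ?S"
        using y by (auto intro: generate.incl generate.inv)
      ultimately show "y \<in> generate G ?S" by (simp add: generate.eng)
    qed
    then show "M \<subseteq> generate G ?S" unfolding M_def by (rule G.generate_subgroup_incl[OF _ sg])
  qed
  then obtain v where v: "G.ham_word M ?S v" using IH[OF M MG SM] by blast
  show ?thesis
  proof (rule G.ham_word_skewed_generators[OF finite_carrier M T(1)])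
    show "set (s # w) \<subseteq> T" using sT by simp
    show "G.list_mult (s # w) \<in> M" using prod by (simp add: x_def)
    show "length (s # w) * card M = order G" using D(5) len w by simp
    show "\<exists>h\<in>M. \<exists>j<length (s # w). g = h \<otimes> G.list_mult (take j (s # w))" if g: "g \<in> carrier G" for g
    proof -
      obtain h j where h: "h \<in> M" "j < n" "g = h \<otimes> G.walk r j" using D(6)[OF g] by blast
      then have "g = h \<otimes> G.list_mult (take j (s # w))" "j < length (s # w)"
        using take[of j] len w by auto
      then show ?thesis using h(1) by blast
    qed
    show "G.ham_word M ((\<lambda>t. t \<otimes> G.list_mult w) ` T) v" using v by (simp add: x_def)
  qed
qed

section \<open>Restoring the generators left out\<close>

lemma generate_Un_kernel:
  assumes T: "T \<subseteq> carrier G" and g: "g \<in> generate G (T \<union> kernel G P \<pi>)"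
  shows "\<exists>h\<in>generate G T. \<exists>z\<in>kernel G P \<pi>. g = h \<otimes> z"
proof -
  have ker: "subgroup (kernel G P \<pi>) G" by (rule subgroup_kernel)
  note kc = subgroup.mem_carrier[OF ker]
  have Tc: "h \<in> carrier G" if "h \<in> generate G T" for h using G.generate_in_carrier[OF T that] .
  show ?thesis
    using g
  proof induction
    case one
    show ?case by (intro bexI[of _ \<one>]) (auto simp: generate.one subgroup.one_closed[OF ker])
  next
    case (incl h)
    show ?case
    proof (cases "h \<in> T")
      case True
      then show ?thesis using T
        by (intro bexI[of _ h] bexI[of _ \<one>]) (auto simp: generate.incl subgroup.one_closed[OF ker])
    next
      case False
      then show ?thesis using incl kc
        by (intro bexI[of _ \<one>] bexI[of _ h]) (auto simp: generate.one)
    qed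
  next
    case (inv h)
    show ?case
    proof (cases "h \<in> T")
      case True
      then show ?thesis using T
        by (intro bexI[of _ "inv h"] bexI[of _ \<one>]) (auto simp: generate.inv subgroup.one_closed[OF ker])
    next
      case False
      then have h: "inv h \<in> kernel G P \<pi>" using inv subgroup.m_inv_closed[OF ker] by auto
      then show ?thesis using kc[OF h]
        by (intro bexI[of _ \<one>] bexI[of _ "inv h"]) (auto simp: generate.one)
    qed
  next
    case (eng g1 g2)
    then obtain h1 z1 h2 z2 where h: "h1 \<in> generate G T" "h2 \<in> generate G T"
      "z1 \<in> kernel G P \<pi>" "z2 \<in> kernel G P \<pi>" "g1 = h1 \<otimes> z1" "g2 = h2 \<otimes> z2" by blast
    have "g1 \<otimes> g2 = h1 \<otimes> (z1 \<otimes> h2) \<otimes> z2"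
      using h Tc kc by (simp add: G.m_assoc)
    also have "z1 \<otimes> h2 = h2 \<otimes> z1" using central[OF h(3) Tc[OF h(2)]] .
    finally have "g1 \<otimes> g2 = (h1 \<otimes> h2) \<otimes> (z1 \<otimes> z2)" using h Tc kc by (simp add: G.m_assoc)
    then show ?case using h generate.eng subgroup.m_closed[OF ker] by metis
  qed
qed

text \<open>Every element of \<open>G\<close> is a product of an element generated by
  \<open>T\<close> and a central one. So conjugation by it preserves every subgroup containing
  \<open>T\<close>, and adjoining generators one at a time gives cyclic extensions.\<close>

lemma ham_word_add_generators:
  assumes T: "T \<subseteq> carrier G" and gen: "generate G (T \<union> kernel G P \<pi>) = carrier G"
    and v: "G.ham_word (generate G T) T v" and F: "finite F" "F \<subseteq> carrier G"
  shows "\<exists>w. G.ham_word (generate G (F \<union> T)) (F \<union> T) w"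
  using F
proof (induction F rule: finite_induct)
  case empty
  then show ?case using v by auto
next
  case (insert s F)
  let ?U = "generate G (F \<union> T)" and ?K = "generate G (insert s (F \<union> T))"
  have FT: "F \<union> T \<subseteq> carrier G" "insert s (F \<union> T) \<subseteq> carrier G" using insert.prems T by auto
  have U: "subgroup ?U G" and K: "subgroup ?K G"
    by (rule G.generate_is_subgroup[OF FT(1)], rule G.generate_is_subgroup[OF FT(2)])
  note Uc = subgroup.mem_carrier[OF U]
  have UK: "?U \<subseteq> ?K" by (rule G.mono_generate) auto
  have TU: "generate G T \<subseteq> ?U" by (rule G.mono_generate) auto
  have "g \<otimes> u \<otimes> inv g \<in> ?U" if g: "g \<in> carrier G" and u: "u \<in> ?U" for g u
  proof -
    obtain h z where h: "h \<in> generate G T" "z \<in> kernel G P \<pi>" "g = h \<otimes> z"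
      using generate_Un_kernel[OF T] g gen by blast
    have c: "h \<in> carrier G" "z \<in> carrier G" "h \<in> ?U"
      using h TU Uc by (auto simp: kernel_def)
    have "g \<otimes> u \<otimes> inv g = h \<otimes> (z \<otimes> u) \<otimes> inv z \<otimes> inv h"
      using h c Uc[OF u] by (simp add: G.m_assoc G.inv_mult_group)
    also have "z \<otimes> u = u \<otimes> z" using central[OF h(2) Uc[OF u]] .
    finally have "g \<otimes> u \<otimes> inv g = h \<otimes> u \<otimes> inv h" using c Uc[OF u] by (simp add: G.m_assoc)
    then show ?thesis using c(3) u U by (simp add: subgroup.m_closed subgroup.m_inv_closed)
  qed
  then have nor: "G.normal_in ?U ?K"
    using U K UK subgroup.mem_carrier[OF K] by (auto simp: G.normal_in_def)
  have sK: "s \<in> ?K" by (simp add: generate.incl)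
  have gens: "generate G (insert s ?U) = ?K"
  proof
    show "generate G (insert s ?U) \<subseteq> ?K" by (rule G.generate_subgroup_incl[OF _ K]) (use sK UK in auto)
    show "?K \<subseteq> generate G (insert s ?U)" by (rule G.mono_generate) (auto intro: generate.incl)
  qed
  obtain w where "G.ham_word ?U (F \<union> T) w" using insert by auto
  moreover have "F \<union> T \<subseteq> ?U" by (auto intro: generate.incl)
  ultimately show ?case
    using G.ham_word_extend[OF finite_carrier nor sK gens] by simp
qed

lemma exists_minimal_generators:
  assumes S: "S \<subseteq> carrier G" and gen: "generate G S = carrier G"
  obtains T where "T \<subseteq> S" "generate G (T \<union> kernel G P \<pi>) = carrier G"
    "\<And>t. t \<in> T \<Longrightarrow> generate G ((T - {t}) \<union> kernel G P \<pi>) \<noteq> carrier G"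
proof -
  let ?Q = "\<lambda>T. T \<subseteq> S \<and> generate G (T \<union> kernel G P \<pi>) = carrier G"
  have ker: "kernel G P \<pi> \<subseteq> carrier G" by (auto simp: kernel_def)
  have "carrier G \<subseteq> generate G (S \<union> kernel G P \<pi>)"
    unfolding gen[symmetric] by (rule G.mono_generate) auto
  moreover have "generate G (S \<union> kernel G P \<pi>) \<subseteq> carrier G"
    by (rule G.generate_incl) (use S ker in auto)
  ultimately have "?Q S" by auto
  then have "\<exists>T. ?Q T \<and> (\<forall>T'. ?Q T' \<longrightarrow> card T \<le> card T')" by (rule ex_has_least_nat)
  then obtain T where T: "?Q T" and least: "\<forall>T'. ?Q T' \<longrightarrow> card T \<le> card T'"
    by (elim exE conjE) (rule that; blast)
  have finT: "finite T" using T S finite_carrier finite_subset by metis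
  show thesis
  proof (rule that)
    show "generate G ((T - {t}) \<union> kernel G P \<pi>) \<noteq> carrier G" if t: "t \<in> T" for t
    proof
      assume eq: "generate G ((T - {t}) \<union> kernel G P \<pi>) = carrier G"
      have "card T \<le> card (T - {t})" by (rule least[rule_format]) (use T eq in auto)
      then show False using card_Diff1_less[OF finT t] by simp
    qed
  qed (use T in auto)
qed

text \<open>\<open>T\<close> was chosen modulo the kernel and may generate a proper subgroup, which
  the induction hypothesis covers; the coset construction treats the case that a nonempty
  \<open>T\<close> generates \<open>G\<close>.\<close>

lemma ham_word_step:
  assumes S: "S \<subseteq> carrier G" and gen: "generate G S = carrier G"
    and IH: "\<And>M S. subgroup M G \<Longrightarrow> M \<noteq> carrier G \<Longrightarrow> S \<subseteq> M \<Longrightarrow> generate G S = M \<Longrightarrow>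
      \<exists>v. G.ham_word M S v"
  shows "\<exists>w. G.ham_word (carrier G) S w"
proof -
  obtain T where T: "T \<subseteq> S" "generate G (T \<union> kernel G P \<pi>) = carrier G"
    "\<And>t. t \<in> T \<Longrightarrow> generate G ((T - {t}) \<union> kernel G P \<pi>) \<noteq> carrier G"
    by (rule exists_minimal_generators[OF S gen]) blast
  have TG: "T \<subseteq> carrier G" using T S by auto
  have "\<exists>v. G.ham_word (generate G T) T v"
  proof (cases "T = {}")
    \<comment> \<open>An empty \<open>T\<close> occurs when all of \<open>G\<close> is the kernel;
      the trivial group is traversed by the empty word.\<close>
    case True
    then show ?thesis by (intro exI[of _ "[]"]) (simp add: G.ham_word_def G.generate_empty)
  next
    case False
    show ?thesis
    proof (cases "generate G T = carrier G")
      case True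
      show ?thesis unfolding True by (rule ham_word_of_minimal[OF TG False True T(3) IH])
    next
      case False
      show ?thesis
        by (rule IH[OF G.generate_is_subgroup[OF TG] False _ refl]) (auto intro: generate.incl)
    qed
  qed
  then obtain v where v: "G.ham_word (generate G T) T v" by blast
  have "finite S" using S finite_carrier by (rule finite_subset)
  moreover have "S \<union> T = S" using T by auto
  ultimately show ?thesis
    using ham_word_add_generators[OF TG T(2) v _ S] gen by simp
qed

end

text \<open>Strong induction on \<open>card K\<close>: the restriction of \<open>\<pi>\<close> to
  \<open>K\<close> again has central kernel, so the step for a whole group applies to
  \<open>K\<close>.\<close>

theorem (in p_group_central_extension) exists_ham_word:
  assumes "subgroup K G" and "S \<subseteq> K" and "generate G S = K"
  shows "\<exists>w. G.ham_word K S w"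
  using assms
proof (induction "card K" arbitrary: K S rule: less_induct)
  case less
  note K = \<open>subgroup K G\<close>
  interpret K: p_group_central_extension "G\<lparr>carrier := K\<rparr>" P \<pi> p k by (rule restrict[OF K])
  have gen: "generate (G\<lparr>carrier := K\<rparr>) A = generate G A" if "A \<subseteq> K" for A
    using G.generate_consistent[OF that K] by simp
  have finK: "finite K" using K.finite_carrier by simp
  have "\<exists>w. K.G.ham_word (carrier (G\<lparr>carrier := K\<rparr>)) S w"
  proof (rule K.ham_word_step)
    fix M A
    assume M: "subgroup M (G\<lparr>carrier := K\<rparr>)" "M \<noteq> carrier (G\<lparr>carrier := K\<rparr>)" "A \<subseteq> M"
      "generate (G\<lparr>carrier := K\<rparr>) A = M"
    have MK: "M \<subset> K" using subgroup.subset[OF M(1)] M(2) by auto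
    have "\<exists>v. G.ham_word M A v"
    proof (rule less.hyps)
      show "card M < card K" using MK finK by (simp add: psubset_card_mono)
      show "subgroup M G" using K M(1) by (rule G.incl_subgroup)
      show "generate G A = M" using M(3,4) MK gen[of A] by auto
    qed (rule M(3))
    then show "\<exists>v. K.G.ham_word M A v" by (simp add: G.ham_word_restrict[OF K])
  qed (use less.prems gen in auto)
  then show ?case by (simp add: G.ham_word_restrict[OF K])
qed

section \<open>Hamiltonian paths\<close>

primrec (in monoid) word_vertices :: "'a \<Rightarrow> 'a list \<Rightarrow> 'a list"
  where
    "word_vertices g [] = [g]"
  | "word_vertices g (s # w) = g # word_vertices (g \<otimes> s) w"

context group
begin

lemma length_word_vertices: "length (word_vertices g w) = Suc (length w)"
  by (induction w arbitrary: g) auto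

lemma word_vertices_closed:
  "g \<in> carrier G \<Longrightarrow> set w \<subseteq> carrier G \<Longrightarrow> set (word_vertices g w) \<subseteq> carrier G"
  by (induction w arbitrary: g) auto

lemma prefix_in_word_vertices:
  "g \<in> carrier G \<Longrightarrow> set (xs @ ys) \<subseteq> carrier G \<Longrightarrow>
    g \<otimes> list_mult xs \<in> set (word_vertices g (xs @ ys))"
proof (induction xs arbitrary: g)
  case Nil
  then show ?case by (cases ys) auto
next
  case (Cons x xs)
  then have "(g \<otimes> x) \<otimes> list_mult xs \<in> set (word_vertices (g \<otimes> x) (xs @ ys))" by simp
  then show ?case using Cons.prems by (simp add: m_assoc)
qed

lemma vwalk_arcs_word_vertices:
  assumes "g \<in> carrier G" "set w \<subseteq> S" "S \<subseteq> carrier G"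
  shows "set (vwalk_arcs (word_vertices g w)) \<subseteq> parcs (cayley_digraph G S)"
  using assms
proof (induction w arbitrary: g)
  case (Cons s w)
  obtain vs where vs: "word_vertices (g \<otimes> s) w = (g \<otimes> s) # vs" by (cases w) auto
  have "(g, g \<otimes> s) \<in> parcs (cayley_digraph G S)"
    using Cons.prems by (auto simp: cayley_digraph_def)
  moreover have "set (vwalk_arcs (word_vertices (g \<otimes> s) w)) \<subseteq> parcs (cayley_digraph G S)"
    using Cons.prems by (intro Cons.IH) auto
  ultimately show ?case by (simp add: vs)
qed simp

text \<open>The list of vertices covers \<open>G\<close> and is no longer than the order of
  \<open>G\<close>, so it has no repetitions.\<close>

lemma ham_word_imp_hamiltonian_path:
  assumes fin: "finite (carrier G)" and S: "S \<subseteq> carrier G" and w: "ham_word (carrier G) S w"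
  shows "hamiltonian_path (word_vertices \<one> w) (with_proj (cayley_digraph G S))"
proof -
  let ?vs = "word_vertices \<one> w"
  have wS: "set w \<subseteq> S" and len: "length w < card (carrier G)" using w by (auto simp: ham_word_def)
  have wG: "set w \<subseteq> carrier G" using wS S by auto
  have "carrier G \<subseteq> set ?vs"
  proof
    fix g assume "g \<in> carrier G"
    then obtain xs ys where xs: "w = xs @ ys" "g = list_mult xs"
      using w by (auto simp: ham_word_def)
    then show "g \<in> set ?vs" using prefix_in_word_vertices[of \<one> xs ys] wG by simp
  qed
  then have set: "set ?vs = carrier G" using word_vertices_closed[OF one_closed wG] by auto
  have "length ?vs \<le> card (set ?vs)" using len by (simp add: set length_word_vertices)
  then have "distinct ?vs" by (simp add: card_distinct card_length le_antisym)
  moreover have "vwalk ?vs (with_proj (cayley_digraph G S))"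
  proof
    show "set ?vs \<subseteq> verts (with_proj (cayley_digraph G S))"
      by (simp add: set cayley_digraph_def)
    show "set (vwalk_arcs ?vs) \<subseteq> arcs_ends (with_proj (cayley_digraph G S))"
      using vwalk_arcs_word_vertices[OF one_closed wS S] by simp
    show "?vs \<noteq> []" using length_word_vertices[of \<one> w] by auto
  qed
  ultimately show ?thesis by (auto simp: hamiltonian_path_def set cayley_digraph_def)
qed

end

theorem theorem1p3:
  fixes P :: "('a, 'm) monoid_scheme" and A :: "('b, 'n) monoid_scheme"
    and p k :: nat and S :: "('a \<times> 'b) set"
  assumes "group P" and "comm_group A"
    and "finite (carrier (P \<times>\<times> A))"
    and "prime p" and "order P = p ^ k"
    and "S \<subseteq> carrier (P \<times>\<times> A)"
    and "generate (P \<times>\<times> A) S = carrier (P \<times>\<times> A)"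
  shows "\<exists>vs. hamiltonian_path vs (with_proj (cayley_digraph (P \<times>\<times> A) S))"
proof -
  interpret P: group P by fact
  interpret A: comm_group A by fact
  \<comment> \<open>The kernel of the first projection consists of the pairs with trivial first
    component, which are central because \<open>A\<close> is abelian.\<close>
  interpret p_group_central_extension "P \<times>\<times> A" P fst p k
  proof (intro p_group_central_extension.intro p_group_central_extension_axioms.intro
      group_hom.intro group_hom_axioms.intro)
    show "group (P \<times>\<times> A)" by (rule DirProd_group) unfold_locales
    show "fst \<in> hom (P \<times>\<times> A) P" by (auto simp: hom_def)
    show "x \<otimes>\<^bsub>P \<times>\<times> A\<^esub> y = y \<otimes>\<^bsub>P \<times>\<times> A\<^esub> x"
      if "x \<in> kernel (P \<times>\<times> A) P fst" "y \<in> carrier (P \<times>\<times> A)" for x y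
      using that by (auto simp: kernel_def A.m_comm)
  qed (use assms in auto)
  obtain w where "G.ham_word (carrier (P \<times>\<times> A)) S w"
    using exists_ham_word[OF G.subgroup_self assms(6,7)] by blast
  then show ?thesis
    using G.ham_word_imp_hamiltonian_path[OF assms(3,6)] by blast
qed

end
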